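(* Let $\|\cdot\|$ be a norm on $\mathbb{R}^n$, let $F$ be a log-concave function on $\mathbb{R}^n$ inducing the measure $\mu_F(A)=\int_A F(x)\,dx$, with compact support $K$, and let $K=S_1\cup S_2\cup B$ be a partition into disjoint measurable sets with $0<\mu_F(S_1)\le\mu_F(S_2)$. Let $d\ge\operatorname{diam}K$ and $0<t\le\operatorname{dist}(S_1,S_2)$, both with respect to $\|\cdot\|$. Let $G:[2,\infty)\to\mathbb{R}^+$ be such that $G$ is monotonically non-decreasing on $[2,\infty)$ and $x\mapsto x\,G(1/x)$ is monotonically non-decreasing on $(0,1/2]$. Suppose that for every real $\gamma$, every $t'\in(0,1)$ and every $s\ge0$ with $s+t'\le 1$, writing $\nu(A)=\int_A e^{\gamma u}\,du$ for $A\subseteq[0,1]$, $S_1'=[0,s)$, $B'=[s,s+t']$, $S_2'=(s+t',1]$, if $0<\nu(S_1')\le\nu(S_2')$ then $$\frac{1-t'}{t'}\,\nu(B')\ \ge\ \nu(S_1')\,G\!\left(\frac{\nu([0,1]\setminus B')}{\nu(S_1')}\right).$$ Then $$\frac{d-t}{t}\,\mu_F(B)\ \ge\ \mu_F(S_1)\,G\!\left(\frac{\mu_F(K\setminus B)}{\mu_F(S_1)}\right).$$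
   Context: A function $F:\mathbb{R}^n\to\mathbb{R}^+$ is log-concave if $F(tx+(1-t)y)\ge F(x)^tF(y)^{1-t}$ for all $x,y$ and $t\in[0,1]$. For a norm $\|\cdot\|$, $\operatorname{diam}K=\sup\{\|a-b\|:a,b\in K\}$ and $\operatorname{dist}(S_1,S_2)=\inf\{\|a-b\|:a\in S_1,b\in S_2\}$. *)

theory Defs
  imports "HOL-Analysis.Analysis"
begin

definition is_norm :: "('a::real_vector \<Rightarrow> real) \<Rightarrow> bool" where
  "is_norm N \<longleftrightarrow> (\<forall>x. N x \<ge> 0) \<and> (\<forall>x. N x = 0 \<longleftrightarrow> x = 0)
     \<and> (\<forall>c x. N (c *\<^sub>R x) = \<bar>c\<bar> * N x) \<and> (\<forall>x y. N (x + y) \<le> N x + N y)"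

text \<open>Log-concavity of a nonnegative function (with 0 powr a = 0).\<close>
definition log_concave :: "('a::real_vector \<Rightarrow> real) \<Rightarrow> bool" where
  "log_concave F \<longleftrightarrow> (\<forall>x. F x \<ge> 0) \<and>
     (\<forall>x y t. 0 \<le> t \<and> t \<le> 1 \<longrightarrow>
        F (t *\<^sub>R x + (1 - t) *\<^sub>R y) \<ge> F x powr t * F y powr (1 - t))"

definition muF :: "('a::euclidean_space \<Rightarrow> real) \<Rightarrow> 'a set \<Rightarrow> real" where
  "muF F A = set_lebesgue_integral lebesgue A F"

definition nu_exp :: "real \<Rightarrow> real set \<Rightarrow> real" where
  "nu_exp \<gamma> A = set_lebesgue_integral lebesgue A (\<lambda>u. exp (\<gamma> * u))"

end

theory Submission
  imports Defs "HOL-Probability.Distribution_Functions"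
begin

text \<open>If the inequality fails, it fails with \<open>(d - t) / t\<close> replaced by a slightly larger \<open>c\<close>.
  Repeated bisection by hyperplanes that preserve the proportion \<open>\<mu>\<^sub>F(S\<^sub>1) : \<mu>\<^sub>F(S\<^sub>2)\<close> keeps the
  failure on one of the two halves, since both sides are additive over the pieces. The pieces shrink
  to a segment, so on a late piece a suitable coordinate separates the two sets by at least \<open>\<tau>\<close>, the
  piece lies in a strip of width \<open>w\<close>, and \<open>(w - \<tau>) / \<tau> \<le> c\<close>. The law of that coordinate has a
  log-concave density by Prekopa's theorem. On the line, comparing the density with the exponential
  that agrees with it at both ends of a gap gives the inequality for a single gap, and arbitrary
  separated sets reduce to at most two gaps because \<open>m \<mapsto> m G(s / m)\<close> is non-decreasing and
  subadditive.\<close>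

section \<open>The inequality on an interval\<close>

text \<open>The proportion is what makes the failure additive: on a piece where the masses of
  \<open>S1\<close> and \<open>S2\<close> stand as \<open>m1\<close> to \<open>m2\<close>, the value
  of \<open>G\<close> is the constant \<open>G ((m1 + m2) / m1)\<close>, so the right-hand side is
  linear in the mass of \<open>S1\<close>. A late piece still has positive mass, and its coordinate
  law takes the place of a needle, so no limit of densities is taken; only the geometry passes to
  the limit, and the slack between \<open>(d - t) / t\<close> and \<open>c\<close> pays for stopping
  early. On the limiting segment the norm is a constant multiple of one coordinate, and the ratio
  \<open>(w - \<tau>) / \<tau>\<close> ignores that multiple. On a late piece the images of the two
  sets may interleave in any order, which is why the line needs a statement about arbitrary
  separated sets and not about three consecutive intervals. The cuts have normals in coordinate
  planes: such a normal is found by turning through one angle, and countably many of these cuts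
  already force the limit into a segment.\<close>

lemma nu_exp_affine:
  assumes "W \<noteq> 0" and "A \<in> sets borel" and "\<And>u. x0 + W * u \<in> X \<longleftrightarrow> u \<in> A"
  shows "(LINT x:X|lborel. exp (k * x)) = \<bar>W\<bar> * exp (k * x0) * nu_exp (k * W) A"
proof -
  have "nu_exp (k * W) A = (LINT u|lborel. indicator A u * exp (k * W * u))"
    unfolding nu_exp_def set_lebesgue_integral_def using assms(2)
    by (subst integral_completion) auto
  moreover have "(LINT x:X|lborel. exp (k * x)) =
      \<bar>W\<bar> * (LINT u|lborel. indicator X (x0 + W * u) * exp (k * (x0 + W * u)))"
    using lborel_integral_real_affine[OF assms(1), of "\<lambda>x. indicator X x * exp (k * x)" x0]
    by (simp add: set_lebesgue_integral_def)
  moreover have "(\<lambda>u. indicator X (x0 + W * u) * exp (k * (x0 + W * u)))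
      = (\<lambda>u. exp (k * x0) * (indicator A u * exp (k * W * u)))"
    using assms(3) by (auto simp: fun_eq_iff indicator_def exp_add[symmetric] algebra_simps)
  ultimately show ?thesis by simp
qed

lemma log_concave_between:
  fixes f :: "real \<Rightarrow> real"
  assumes "log_concave f" "f x > 0" "f y > 0" "x \<le> z" "z \<le> y" "x < y"
  shows "f z > 0" "(y - z) * ln (f x) + (z - x) * ln (f y) \<le> (y - x) * ln (f z)"
proof -
  define t where "t = (y - z) / (y - x)"
  have t: "0 \<le> t" "t \<le> 1" using assms by (auto simp: t_def field_simps)
  have t': "1 - t = (z - x) / (y - x)" using assms by (simp add: t_def field_simps)
  have "t * x + (1 - t) * y = ((y - z) * x + (z - x) * y) / (y - x)"
    by (simp add: t' add_divide_distrib) (simp add: t_def)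
  also have "\<dots> = z" using assms by (simp add: field_simps)
  finally have "f z \<ge> f x powr t * f y powr (1 - t)"
    using assms(1) t unfolding log_concave_def by (metis real_scaleR_def)
  moreover have "f x powr t * f y powr (1 - t) = exp (t * ln (f x) + (1 - t) * ln (f y))"
    using assms by (simp add: powr_def exp_add)
  ultimately have *: "f z \<ge> exp (t * ln (f x) + (1 - t) * ln (f y))" by simp
  then show "f z > 0" using exp_gt_zero less_le_trans by blast
  then have "t * ln (f x) + (1 - t) * ln (f y) \<le> ln (f z)"
    using * by (simp add: ln_ge_iff)
  then have "(y - x) * (t * ln (f x) + (1 - t) * ln (f y)) \<le> (y - x) * ln (f z)"
    using assms by (intro mult_left_mono) auto
  moreover have "(y - x) * t = y - z" "(y - x) * (1 - t) = z - x"
    using assms by (auto simp: t_def field_simps)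
  ultimately show "(y - z) * ln (f x) + (z - x) * ln (f y) \<le> (y - x) * ln (f z)"
    by (simp only: distrib_left mult.assoc[symmetric])
qed

section \<open>The profile \<open>m * G (s / m)\<close> and windows of exponential and log-concave
  weights\<close>

locale needle_bound =
  fixes G :: "real \<Rightarrow> real"
  assumes G_nonneg: "\<And>x. x \<ge> 2 \<Longrightarrow> G x \<ge> 0"
    and G_mono: "mono_on {2..} G"
    and G_mono2: "mono_on {0<..1/2} (\<lambda>x. x * G (1 / x))"
    and one_dim: "\<And>\<gamma> t' s. 0 < t' \<Longrightarrow> t' < 1 \<Longrightarrow> 0 \<le> s \<Longrightarrow> s + t' \<le> 1 \<Longrightarrow>
         0 < nu_exp \<gamma> {0..<s} \<Longrightarrow> nu_exp \<gamma> {0..<s} \<le> nu_exp \<gamma> {s+t'<..1} \<Longrightarrow>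
         nu_exp \<gamma> {0..<s} * G (nu_exp \<gamma> ({0..1} - {s..s+t'}) / nu_exp \<gamma> {0..<s})
           \<le> (1 - t') / t' * nu_exp \<gamma> {s..s+t'}"
begin

text \<open>With \<open>x = m / s'\<close> one has
  \<open>m * G (s' / m) = s' * (x * G (1 / x))\<close>, so growth in \<open>m\<close> is the second
  monotonicity hypothesis and growth in \<open>s\<close> the first. The conditions
  \<open>2 * m \<le> s\<close> and \<open>2 * m' \<le> s'\<close> keep all arguments inside the two
  domains.\<close>

lemma profile_mono:
  assumes "0 < m" "m \<le> m'" "s \<le> s'" "2 * m \<le> s" "2 * m' \<le> s'"
  shows "m * G (s / m) \<le> m' * G (s' / m')"
proof -
  have "m * G (s / m) \<le> m * G (s' / m)"
    using assms by (intro mult_left_mono mono_onD[OF G_mono]) (auto simp: field_simps)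
  also have "\<dots> = s' * (m / s' * G (1 / (m / s')))" using assms by (simp add: field_simps)
  also have "\<dots> \<le> s' * (m' / s' * G (1 / (m' / s')))"
    using assms by (intro mult_left_mono mono_onD[OF G_mono2]) (auto simp: field_simps)
  also have "\<dots> = m' * G (s' / m')" using assms by (simp add: field_simps)
  finally show ?thesis .
qed

lemma profile_nonneg:
  assumes "0 < m" "2 * m \<le> s"
  shows "0 \<le> m * G (s / m)"
  using assms by (intro mult_nonneg_nonneg G_nonneg) (auto simp: field_simps)

text \<open>If \<open>m\<close> exceeds both \<open>a\<close> and \<open>b\<close>, then
  \<open>G (s / a)\<close> and \<open>G (s / b)\<close> are at least \<open>G (s / m)\<close>, and
  \<open>m \<le> a + b\<close> finishes. Otherwise one summand alone dominates and the other is
  nonnegative.\<close>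

lemma profile_subadd:
  assumes "0 < m" "0 < a" "0 < b" "m \<le> a + b" "2 * m \<le> s" "2 * a \<le> s" "2 * b \<le> s"
  shows "m * G (s / m) \<le> a * G (s / a) + b * G (s / b)"
proof -
  have nn: "0 \<le> a * G (s / a)" "0 \<le> b * G (s / b)" using assms profile_nonneg by auto
  consider "m \<le> a" | "m \<le> b" | "a < m" "b < m" by linarith
  then show ?thesis
  proof cases
    case 1 then show ?thesis using profile_mono[of m a s s] assms nn by auto
  next
    case 2 then show ?thesis using profile_mono[of m b s s] assms nn by auto
  next
    case 3
    have "G (s / m) \<le> G (s / a)" "G (s / m) \<le> G (s / b)"
      using assms 3 by (auto intro!: mono_onD[OF G_mono] divide_left_mono simp: field_simps)
    then have "a * G (s / m) \<le> a * G (s / a)" "b * G (s / m) \<le> b * G (s / b)"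
      using assms by auto
    moreover have "m * G (s / m) \<le> (a + b) * G (s / m)"
      using assms by (intro mult_right_mono G_nonneg) (auto simp: field_simps)
    ultimately show ?thesis by (simp add: algebra_simps)
  qed
qed

lemma exp_window_affine:
  fixes W x0 k t' s :: real
  assumes "W \<noteq> 0" "0 < t'" "t' < 1" "0 \<le> s" "s + t' \<le> 1"
    and X: "\<And>u. x0 + W * u \<in> X \<longleftrightarrow> u \<in> {0..<s}"
    and Y: "\<And>u. x0 + W * u \<in> Y \<longleftrightarrow> u \<in> {s+t'<..1}"
    and Z: "\<And>u. x0 + W * u \<in> Z \<longleftrightarrow> u \<in> {s..s+t'}"
    and L: "L = (LINT x:X|lborel. exp (k * x))" "0 < L" "L \<le> R"
    and R: "R = (LINT x:Y|lborel. exp (k * x))"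
  shows "L * G ((L + R) / L) \<le> (1 - t') / t' * (LINT x:Z|lborel. exp (k * x))"
proof -
  define C where "C = \<bar>W\<bar> * exp (k * x0)"
  have C: "C > 0" using assms by (simp add: C_def)
  let ?n = "nu_exp (k * W)"
  have eq: "L = C * ?n {0..<s}" "R = C * ?n {s+t'<..1}"
      "(LINT x:Z|lborel. exp (k * x)) = C * ?n {s..s+t'}"
    unfolding L(1) R C_def
    by (intro nu_exp_affine X Y Z assms; simp)+
  have int: "set_integrable lebesgue A (\<lambda>u. exp (k * W * u))" if "A \<in> sets borel" "A \<subseteq> {0..1}" for A
  proof -
    have "set_integrable lborel {0..1} (\<lambda>u. exp (k * W * u))"
      by (intro borel_integrable_atLeastAtMost' continuous_intros)
    then have "set_integrable lborel A (\<lambda>u. exp (k * W * u))"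
      using that by (auto intro: set_integrable_subset)
    then show ?thesis unfolding set_integrable_def using that
      by (subst integrable_completion) auto
  qed
  have "{0..1} - {s..s+t'} = {0..<s} \<union> {s+t'<..1}" using assms by auto
  then have sum: "?n ({0..1} - {s..s+t'}) = ?n {0..<s} + ?n {s+t'<..1}"
    unfolding nu_exp_def using assms by (auto intro!: set_integral_Un int)
  have "?n {0..<s} * G (?n ({0..1} - {s..s+t'}) / ?n {0..<s}) \<le> (1 - t') / t' * ?n {s..s+t'}"
  proof (intro one_dim)
    show "0 < ?n {0..<s}" using L(2) C unfolding eq(1) by (simp add: zero_less_mult_iff)
    show "?n {0..<s} \<le> ?n {s+t'<..1}" using L(3) C unfolding eq(1,2) by simp
  qed (use assms in auto)
  then have "C * (?n {0..<s} * G ((?n {0..<s} + ?n {s+t'<..1}) / ?n {0..<s})) \<le> C * ((1 - t') / t' * ?n {s..s+t'})"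
    using C unfolding sum by (intro mult_left_mono) auto
  moreover have "(L + R) / L = (?n {0..<s} + ?n {s+t'<..1}) / ?n {0..<s}"
    using C unfolding eq by (simp add: distrib_left[symmetric])
  ultimately show ?thesis unfolding eq(3) using eq(1) by (simp add: mult_ac)
qed

text \<open>The hypothesis speaks of a lighter left part. If the right part is the lighter one, the
  interval is read backwards from \<open>\<beta>\<close> with scale factor \<open>- W\<close>.
  Rescaling to length 1 turns \<open>\<tau>\<close> into \<open>\<tau> / W\<close>, whence the
  factor \<open>(\<beta> - \<alpha> - \<tau>) / \<tau>\<close>.\<close>

lemma exp_window:
  fixes \<alpha> \<beta> \<tau> s k :: real
  assumes "0 < \<tau>" "\<alpha> < s" "s + \<tau> < \<beta>"
    and L: "L = (LINT x:{\<alpha>..<s}|lborel. exp (k * x))" "0 < L"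
    and R: "R = (LINT x:{s+\<tau><..\<beta>}|lborel. exp (k * x))" "0 < R"
  shows "min L R * G ((L + R) / min L R) \<le> (\<beta> - \<alpha> - \<tau>) / \<tau> * (LINT x:{s..s+\<tau>}|lborel. exp (k * x))"
proof -
  define W where "W = \<beta> - \<alpha>"
  then have W: "W > 0" "\<tau> < W" "W = \<beta> - \<alpha>" using assms by auto
  have q: "(1 - \<tau> / W) / (\<tau> / W) = (\<beta> - \<alpha> - \<tau>) / \<tau>"
    using W assms by (simp add: W_def field_simps)
  show ?thesis
  proof (cases "L \<le> R")
    case True
    have "L * G ((L + R) / L) \<le> (1 - \<tau> / W) / (\<tau> / W) * (LINT x:{s..s+\<tau>}|lborel. exp (k * x))"
    proof (rule exp_window_affine[where W = W and ?x0.0 = \<alpha> and s = "(s - \<alpha>) / W"])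
      show "\<alpha> + W * u \<in> {\<alpha>..<s} \<longleftrightarrow> u \<in> {0..<(s - \<alpha>) / W}" for u
        using W by (auto simp: field_simps zero_le_mult_iff)
      have "\<alpha> + W * u \<le> \<beta> \<longleftrightarrow> u \<le> 1" for u
        using mult_le_cancel_left_pos[OF W(1), of u 1] W(3) by linarith
      then show "\<alpha> + W * u \<in> {s+\<tau><..\<beta>} \<longleftrightarrow> u \<in> {(s - \<alpha>) / W + \<tau> / W<..1}" for u
        using W(1,2) by (auto simp: add_divide_distrib[symmetric] pos_divide_less_eq mult.commute[of W])
      show "\<alpha> + W * u \<in> {s..s+\<tau>} \<longleftrightarrow> u \<in> {(s - \<alpha>) / W..(s - \<alpha>) / W + \<tau> / W}" for u
        using W by (auto simp: add_divide_distrib[symmetric] pos_divide_le_eq pos_le_divide_eq algebra_simps)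
    qed (use W assms True in \<open>auto simp: add_divide_distrib[symmetric] pos_divide_le_eq W_def\<close>)
    then show ?thesis unfolding q using True by (simp add: min_def)
  next
    case False
    have "R * G ((R + L) / R) \<le> (1 - \<tau> / W) / (\<tau> / W) * (LINT x:{s..s+\<tau>}|lborel. exp (k * x))"
    proof (rule exp_window_affine[where W = "- W" and ?x0.0 = \<beta> and s = "(\<beta> - s - \<tau>) / W"])
      show "\<beta> + - W * u \<in> {s+\<tau><..\<beta>} \<longleftrightarrow> u \<in> {0..<(\<beta> - s - \<tau>) / W}" for u
        using W by (auto simp: field_simps zero_le_mult_iff)
      have "\<alpha> \<le> \<beta> - W * u \<longleftrightarrow> u \<le> 1" for u
        using mult_le_cancel_left_pos[OF W(1), of u 1] W(3) by linarith
      then show "\<beta> + - W * u \<in> {\<alpha>..<s} \<longleftrightarrow> u \<in> {(\<beta> - s - \<tau>) / W + \<tau> / W<..1}" for u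
        using W(1,2) by (auto simp: add_divide_distrib[symmetric] pos_divide_less_eq mult.commute[of W])
      show "\<beta> + - W * u \<in> {s..s+\<tau>} \<longleftrightarrow> u \<in> {(\<beta> - s - \<tau>) / W..(\<beta> - s - \<tau>) / W + \<tau> / W}" for u
        using W by (auto simp: add_divide_distrib[symmetric] pos_divide_le_eq pos_le_divide_eq algebra_simps)
    qed (use W assms False in \<open>auto simp: add_divide_distrib[symmetric] pos_divide_le_eq W_def\<close>)
    then show ?thesis unfolding q using False by (simp add: min_def add.commute)
  qed
qed

text \<open>Passing to the exponential raises both outer masses and lowers the mass of the gap, and
  by \<open>profile_mono\<close> larger outer masses can only raise the left-hand side. So the bound
  for the exponential on \<open>{\<alpha>..\<beta>}\<close> implies the one for
  \<open>f\<close>.\<close>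

lemma log_concave_window:
  fixes f :: "real \<Rightarrow> real"
  assumes lc: "log_concave f" and int: "integrable lborel f"
    and zero: "\<And>x. x \<notin> {\<alpha><..<\<beta>} \<Longrightarrow> f x = 0" and "0 < \<tau>"
    and L: "L = (LINT x:{..<s}|lborel. f x)" "0 < L"
    and R: "R = (LINT x:{s+\<tau><..}|lborel. f x)" "0 < R"
  shows "min L R * G ((L + R) / min L R) \<le> (\<beta> - \<alpha> - \<tau>) / \<tau> * (LINT x:{s..s+\<tau>}|lborel. f x)"
proof -
  have nn: "f x \<ge> 0" for x using lc by (simp add: log_concave_def)
  have fint: "set_integrable lborel A f" if "A \<in> sets borel" for A
    unfolding set_integrable_def using that int integrable_mult_indicator[of A lborel f] by simp
  \<comment> \<open>A positive value on each side forces \<open>f\<close> to be positive at both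
    ends of the gap, so that its logarithm can be interpolated there.\<close>
  obtain y0 where y0: "y0 < s" "f y0 > 0"
  proof -
    have "\<exists>y<s. f y \<noteq> 0"
    proof (rule ccontr)
      assume "\<not> ?thesis"
      then have "L = 0" unfolding L(1) set_lebesgue_integral_def
        by (intro integral_eq_zero_AE) (auto simp: indicator_def)
      then show False using L by simp
    qed
    then show ?thesis using that nn by (metis order_le_less)
  qed
  obtain y1 where y1: "s + \<tau> < y1" "f y1 > 0"
  proof -
    have "\<exists>y>s+\<tau>. f y \<noteq> 0"
    proof (rule ccontr)
      assume "\<not> ?thesis"
      then have "R = 0" unfolding R(1) set_lebesgue_integral_def
        by (intro integral_eq_zero_AE) (auto simp: indicator_def)
      then show False using R by simp
    qed
    then show ?thesis using that nn by (metis order_le_less)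
  qed
  have ab: "\<alpha> < y0" "y1 < \<beta>" using zero[of y0] zero[of y1] y0 y1 by force+
  define p q where "p = ln (f s)" and "q = ln (f (s + \<tau>))"
  define k where "k = (q - p) / \<tau>"
  define a where "a = p - k * s"
  have pos: "f s > 0" "f (s + \<tau>) > 0"
    using log_concave_between(1)[OF lc y0(2) y1(2)] y0 y1 \<open>0 < \<tau>\<close> by auto
  have k\<tau>: "k * \<tau> = q - p" using \<open>0 < \<tau>\<close> by (simp add: k_def)
  txt \<open>The exponential through the two endpoint values lies below \<open>f\<close> on the gap and above it
    elsewhere.\<close>
  have inside: "exp a * exp (k * x) \<le> f x" if "s \<le> x" "x \<le> s + \<tau>" for x
  proof -
    have "f x > 0" "(s + \<tau> - x) * p + (x - s) * q \<le> \<tau> * ln (f x)"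
      using log_concave_between[OF lc pos that] \<open>0 < \<tau>\<close> by (auto simp: p_def q_def)
    moreover have "(s + \<tau> - x) * p + (x - s) * q = \<tau> * (a + k * x)"
    proof -
      have "\<tau> * (a + k * x) = \<tau> * p + (k * \<tau>) * (x - s)" by (simp add: a_def algebra_simps)
      then show ?thesis unfolding k\<tau> by (simp add: algebra_simps)
    qed
    ultimately show ?thesis using \<open>0 < \<tau>\<close> by (simp add: exp_add[symmetric] ln_ge_iff)
  qed
  have outside: "f x \<le> exp a * exp (k * x)" if "x < s \<or> s + \<tau> < x" for x
  proof (cases "f x = 0")
    case False
    then have fx: "f x > 0" using nn[of x] by linarith
    have "\<tau> * ln (f x) \<le> \<tau> * (a + k * x)"
    proof (cases "x < s")
      case True
      then have "(s + \<tau> - s) * ln (f x) + (s - x) * q \<le> (s + \<tau> - x) * p"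
        using log_concave_between(2)[OF lc fx pos(2), of s] \<open>0 < \<tau>\<close> by (auto simp: p_def q_def)
      moreover have "\<tau> * (a + k * x) = \<tau> * p + (k * \<tau>) * (x - s)" by (simp add: a_def algebra_simps)
      ultimately show ?thesis unfolding k\<tau> by (simp add: algebra_simps)
    next
      case False
      then have "(x - (s + \<tau>)) * p + (s + \<tau> - s) * ln (f x) \<le> (x - s) * q"
        using log_concave_between(2)[OF lc pos(1) fx, of "s + \<tau>"] \<open>0 < \<tau>\<close> that by (auto simp: p_def q_def)
      moreover have "\<tau> * (a + k * x) = \<tau> * p + (k * \<tau>) * (x - s)" by (simp add: a_def algebra_simps)
      ultimately show ?thesis unfolding k\<tau> by (simp add: algebra_simps)
    qed
    then have "ln (f x) \<le> a + k * x" using \<open>0 < \<tau>\<close> by simp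
    then show ?thesis using fx by (metis exp_add exp_le_cancel_iff exp_ln)
  qed simp
  let ?E = "\<lambda>A. LINT x:A|lborel. exp (k * x)"
  have eint: "set_integrable lborel A (\<lambda>x. exp a * exp (k * x))"
    if "A \<in> sets borel" "A \<subseteq> {u..v}" for A u v
  proof -
    have "set_integrable lborel {u..v} (\<lambda>x. exp a * exp (k * x))"
      by (intro borel_integrable_atLeastAtMost' continuous_intros)
    then show ?thesis using that by (auto intro: set_integrable_subset)
  qed
  have "L = (LINT x:{\<alpha>..<s}|lborel. f x)"
    unfolding L(1) set_lebesgue_integral_def
    by (intro Bochner_Integration.integral_cong) (auto simp: indicator_def zero)
  also have "\<dots> \<le> (LINT x:{\<alpha>..<s}|lborel. exp a * exp (k * x))"
    by (intro set_integral_mono fint eint[of _ \<alpha> s] outside) auto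
  finally have Lle: "L \<le> exp a * ?E {\<alpha>..<s}" by simp
  have "R = (LINT x:{s+\<tau><..\<beta>}|lborel. f x)"
    unfolding R(1) set_lebesgue_integral_def
    by (intro Bochner_Integration.integral_cong) (auto simp: indicator_def zero)
  also have "\<dots> \<le> (LINT x:{s+\<tau><..\<beta>}|lborel. exp a * exp (k * x))"
    by (intro set_integral_mono fint eint[of _ "s+\<tau>" \<beta>] outside) auto
  finally have Rle: "R \<le> exp a * ?E {s+\<tau><..\<beta>}" by simp
  have "(LINT x:{s..s+\<tau>}|lborel. exp a * exp (k * x)) \<le> (LINT x:{s..s+\<tau>}|lborel. f x)"
    by (intro set_integral_mono fint eint[of _ s "s+\<tau>"] inside) auto
  then have Cle: "exp a * ?E {s..s+\<tau>} \<le> (LINT x:{s..s+\<tau>}|lborel. f x)" by simp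
  define l r where "l = ?E {\<alpha>..<s}" and "r = ?E {s+\<tau><..\<beta>}"
  have "exp a * l > 0" "exp a * r > 0" using Lle Rle L R unfolding l_def r_def by linarith+
  then have lr: "l > 0" "r > 0" by (auto simp: zero_less_mult_iff)
  have "min L R * G ((L + R) / min L R)
      \<le> (exp a * min l r) * G ((exp a * (l + r)) / (exp a * min l r))"
    using Lle Rle L R unfolding l_def[symmetric] r_def[symmetric]
    by (intro profile_mono) (auto simp: min_def algebra_simps)
  also have "\<dots> = exp a * (min l r * G ((l + r) / min l r))" by simp
  also have "\<dots> \<le> exp a * ((\<beta> - \<alpha> - \<tau>) / \<tau> * ?E {s..s+\<tau>})"
    using lr ab y0 y1 \<open>0 < \<tau>\<close> by (intro mult_left_mono exp_window l_def r_def) auto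
  also have "\<dots> = (\<beta> - \<alpha> - \<tau>) / \<tau> * (exp a * ?E {s..s+\<tau>})" by simp
  also have "\<dots> \<le> (\<beta> - \<alpha> - \<tau>) / \<tau> * (LINT x:{s..s+\<tau>}|lborel. f x)"
    using ab y0 y1 \<open>0 < \<tau>\<close> by (intro mult_left_mono Cle) auto
  finally show ?thesis .
qed

end

text \<open>Take \<open>p\<close> as the supremum of the points of \<open>T1\<close> up to
  \<open>x2\<close>, and \<open>q\<close> as the infimum of the points of \<open>T2\<close> from
  \<open>p\<close> on. Neither set has a point strictly between them, and the separation passes to
  these limits even if they are not attained, so \<open>q - p\<close> is at least
  \<open>\<tau>\<close>.\<close>

lemma exists_gap:
  fixes T1 T2 :: "real set"
  assumes sep: "\<And>x y. x \<in> T1 \<Longrightarrow> y \<in> T2 \<Longrightarrow> \<tau> \<le> \<bar>x - y\<bar>"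
    and x: "x1 \<in> T1" "x2 \<in> T2" "x1 < x2"
  obtains p where "x1 \<le> p" "p + \<tau> \<le> x2" "{p<..<p+\<tau>} \<inter> (T1 \<union> T2) = {}"
proof -
  define A where "A = T1 \<inter> {..x2}"
  define p where "p = Sup A"
  define C where "C = T2 \<inter> {p..}"
  define q where "q = Inf C"
  have A: "A \<noteq> {}" "bdd_above A" using x by (auto simp: A_def)
  have x1p: "x1 \<le> p" unfolding p_def using x A by (intro cSup_upper) (auto simp: A_def)
  have px2: "p \<le> x2" unfolding p_def using A by (intro cSup_least) (auto simp: A_def)
  have C: "C \<noteq> {}" "bdd_below C" using x px2 by (auto simp: C_def)
  have qx2: "q \<le> x2" unfolding q_def using x px2 C by (intro cInf_lower) (auto simp: C_def)
  have pq: "p + \<tau> \<le> q"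
  proof -
    have "y - \<tau> \<ge> p" if y: "y \<in> C" for y
      unfolding p_def
    proof (rule cSup_least[OF A(1)])
      fix z assume z: "z \<in> A"
      then have "z \<le> p" unfolding p_def by (intro cSup_upper A)
      then show "z \<le> y - \<tau>" using sep[of z y] y z by (auto simp: A_def C_def)
    qed
    then have "y \<ge> p + \<tau>" if "y \<in> C" for y using that by force
    then show ?thesis unfolding q_def using C by (intro cInf_greatest) auto
  qed
  have "z \<notin> T1 \<union> T2" if "p < z" "z < p + \<tau>" for z
  proof
    assume "z \<in> T1 \<union> T2"
    moreover have "z \<le> x2" "p \<le> z" using that pq qx2 by auto
    ultimately have "z \<in> A \<or> z \<in> C" by (auto simp: A_def C_def)
    then show False
      using cSup_upper[of z A] cInf_lower[of z C] A C that pq by (auto simp: p_def q_def)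
  qed
  then have "{p<..<p+\<tau>} \<inter> (T1 \<union> T2) = {}" by auto
  moreover have "p + \<tau> \<le> x2" using pq qx2 by simp
  ultimately show ?thesis using that x1p by blast
qed

section \<open>From a single gap to arbitrary separated sets on the line\<close>

context needle_bound begin

text \<open>Let \<open>p\<close> be the last gap with at most as much mass on its left as on its right, and \<open>r\<close> the
  first gap for which it is the other way round. Only one of the two sets meets the region
  between them, so the other one lies left of \<open>p\<close> or right of \<open>r\<close>, and subadditivity combines the
  inequalities for these two gaps.\<close>
lemma separated_sets_on_line:
  fixes X :: "'b \<Rightarrow> real" and f :: "real \<Rightarrow> real"
  assumes "finite_measure M" and X: "X \<in> borel_measurable M"
    and dens: "distr M borel X = density lborel (\<lambda>x. ennreal (f x))"
    and fb: "f \<in> borel_measurable borel" and lc: "log_concave f"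
    and zero: "\<And>x. x \<notin> {\<alpha><..<\<beta>} \<Longrightarrow> f x = 0" and "0 < \<tau>"
    and sets: "S1 \<in> sets M" "S2 \<in> sets M" "B \<in> sets M"
    and disj: "S1 \<inter> B = {}" "S2 \<inter> B = {}" "S1 \<inter> S2 = {}"
    and cover: "AE x in M. x \<in> S1 \<union> S2 \<union> B"
    and range: "X ` (S1 \<union> S2) \<subseteq> {\<alpha><..<\<beta>}"
    and sep: "\<And>x y. x \<in> S1 \<Longrightarrow> y \<in> S2 \<Longrightarrow> \<tau> \<le> \<bar>X x - X y\<bar>"
    and m: "m = min (measure M S1) (measure M S2)" "0 < m"
  shows "m * G ((measure M S1 + measure M S2) / m) \<le> (\<beta> - \<alpha> - \<tau>) / \<tau> * measure M B"
proof -
  interpret finite_measure M by fact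
  note X[measurable] sets[measurable] fb[measurable]
  define D where "D = distr M borel X"
  interpret D: finite_borel_measure D
    unfolding D_def by (intro finite_borel_measure.intro finite_measure_distr X)
      (simp add: finite_borel_measure_axioms_def)
  have nn: "f x \<ge> 0" for x using lc by (simp add: log_concave_def)
  have space: "space D = UNIV" by (simp add: D_def)
  have Dd: "D = density lborel (\<lambda>x. ennreal (f x))" using dens D_def by simp
  have fint: "integrable lborel f"
  proof (rule integrableI_nonneg)
    have "(\<integral>\<^sup>+ x. ennreal (f x) \<partial>lborel) = emeasure D UNIV"
      unfolding Dd by (subst emeasure_density) auto
    also have "\<dots> < \<infinity>" by (simp add: D.emeasure_eq_measure)
    finally show "(\<integral>\<^sup>+ x. ennreal (f x) \<partial>lborel) < \<infinity>" .
  qed (use nn in auto)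
  have DL: "measure D A = (LINT x:A|lborel. f x)" if A: "A \<in> sets borel" for A
  proof -
    have "emeasure D A = (\<integral>\<^sup>+ x. ennreal (f x) * indicator A x \<partial>lborel)"
      unfolding Dd using A by (intro emeasure_density) auto
    also have "\<dots> = (\<integral>\<^sup>+ x. ennreal (indicator A x * f x) \<partial>lborel)"
      by (intro nn_integral_cong) (auto simp: indicator_def)
    also have "\<dots> = ennreal (LINT x|lborel. indicator A x * f x)"
      using integrable_mult_indicator[of A lborel f] fint A nn
      by (intro nn_integral_eq_integral) auto
    finally show ?thesis using nn
      by (simp add: measure_def set_lebesgue_integral_def integral_nonneg_AE)
  qed
  have atom: "measure D {x} = 0" for x
  proof -
    have "AE y in lborel. indicator {x} y * f y = 0"
      using AE_lborel_singleton[of x] by eventually_elim (auto simp: indicator_def)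
    then show ?thesis using DL[of "{x}"] by (simp add: set_lebesgue_integral_def integral_eq_zero_AE)
  qed
  have DM: "measure D A = measure M (X -` A \<inter> space M)" if "A \<in> sets borel" for A
    unfolding D_def using that by (simp add: measure_distr)
  define V where "V = measure D UNIV"
  \<comment> \<open>The masses on either side of the window \<open>{s..s+\<tau>}\<close>. Since the
    law has no atoms, end points may be added or dropped, and both masses vary continuously with
    \<open>s\<close>.\<close>
  define L where "L s = measure D {..s}" for s
  define R where "R s = measure D {s+\<tau>..}" for s
  have L_lt: "L s = measure D {..<s}" for s
  proof -
    have "measure D ({..<s} \<union> {s}) = measure D {..<s} + measure D {s}"
      by (intro D.finite_measure_Union) (auto simp: Dd)
    moreover have "{..<s} \<union> {s} = {..s}" by auto
    ultimately show ?thesis unfolding L_def using atom by simp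
  qed
  have R_eq: "R s = V - measure D {..s + \<tau>}" for s
  proof -
    have "R s = V - measure D {..<s+\<tau>}"
      using D.finite_measure_compl[of "{..<s+\<tau>}"]
      by (simp add: R_def V_def space Dd Compl_eq_Diff_UNIV[symmetric])
    then show ?thesis using L_lt[of "s+\<tau>"] by (simp add: L_def)
  qed
  have R_gt: "R s = measure D {s+\<tau><..}" for s
    using D.finite_measure_compl[of "{..s+\<tau>}"]
    by (simp add: R_eq V_def space Dd Compl_eq_Diff_UNIV[symmetric])
  have contL: "isCont L s" for s
    using D.isCont_cdf[of s] atom unfolding L_def cdf_def2 by (auto simp: cdf_def)
  have contR: "isCont R s" for s
    unfolding R_eq using isCont_o2[where f = "\<lambda>s. s + \<tau>" and g = L and a = s] contL
    by (auto simp: L_def[abs_def] intro!: continuous_intros)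
  have Lmono: "L s \<le> L s'" if "s \<le> s'" for s s'
    unfolding L_def using that by (intro D.finite_measure_mono) (auto simp: Dd)
  have Rmono: "R s' \<le> R s" if "s \<le> s'" for s s'
    unfolding R_def using that by (intro D.finite_measure_mono) (auto simp: Dd)
  define T1 T2 where "T1 = X ` S1" and "T2 = X ` S2"
  \<comment> \<open>The interval is open so that the set of gaps is closed; the extreme gaps
    \<open>p\<close> and \<open>r\<close> below are then attained.\<close>
  define gap where "gap s \<longleftrightarrow> {s<..<s+\<tau>} \<inter> (T1 \<union> T2) = {}" for s
  have closed_gap: "closed {s. gap s}"
  proof -
    have "{s. gap s} = (\<Inter>x\<in>T1\<union>T2. {s. \<not> (s < x \<and> x < s + \<tau>)})" by (auto simp: gap_def)
    moreover have "closed {s. \<not> (s < x \<and> x < s + \<tau>)}" for x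
    proof -
      have "{s. \<not> (s < x \<and> x < s + \<tau>)} = {x..} \<union> {..x - \<tau>}" by auto
      then show ?thesis by (simp add: closed_Un)
    qed
    ultimately show ?thesis by (simp add: closed_INT)
  qed
  define \<sigma> where "\<sigma> = measure M S1 + measure M S2"
  have \<sigma>: "2 * m \<le> \<sigma>" using m by (simp add: \<sigma>_def min_def)
  have outer: "measure M S \<le> L s + R r"
    if S: "S \<in> sets M" "X ` S \<subseteq> {..s} \<union> {r+\<tau>..}" for S s r
  proof -
    have "measure M S \<le> measure M ((X -` {..s} \<inter> space M) \<union> (X -` {r+\<tau>..} \<inter> space M))"
      using S sets.sets_into_space[OF S(1)] by (intro finite_measure_mono) auto
    also have "\<dots> \<le> measure M (X -` {..s} \<inter> space M) + measure M (X -` {r+\<tau>..} \<inter> space M)"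
      by (intro measure_Un_le) auto
    finally show ?thesis by (simp add: L_def R_def DM)
  qed
  have total: "\<sigma> \<le> L s + R s" if "gap s" for s
  proof -
    have "measure M (S1 \<union> S2) = \<sigma>" unfolding \<sigma>_def by (intro finite_measure_Union sets disj)
    moreover have "X ` (S1 \<union> S2) \<subseteq> {..s} \<union> {s+\<tau>..}"
    proof
      fix x assume "x \<in> X ` (S1 \<union> S2)"
      then have "x \<notin> {s<..<s+\<tau>}" using that unfolding gap_def T1_def T2_def by blast
      then show "x \<in> {..s} \<union> {s+\<tau>..}" by auto
    qed
    ultimately show ?thesis using outer[of "S1 \<union> S2" s s] by simp
  qed
  define c where "c = (\<beta> - \<alpha> - \<tau>) / \<tau>"
  \<comment> \<open>The total \<open>\<sigma>\<close> of the two sets stands in \<open>G\<close>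
    instead of \<open>L s + R s\<close>, which is at least as large. The mass \<open>a\<close> is
    left free: it will be \<open>m\<close>, \<open>L p\<close> or \<open>R r\<close>.\<close>
  have window: "a * G (\<sigma> / a) \<le> c * measure D {s..s+\<tau>}"
    if s: "gap s" "0 < a" "a \<le> L s" "a \<le> R s" "2 * a \<le> \<sigma>" for s a
  proof -
    have "a * G (\<sigma> / a) \<le> min (L s) (R s) * G ((L s + R s) / min (L s) (R s))"
      using s total[of s] by (intro profile_mono) auto
    also have "\<dots> \<le> c * (LINT x:{s..s+\<tau>}|lborel. f x)" unfolding c_def
      using s by (intro log_concave_window lc fint zero \<open>0 < \<tau>\<close>) (auto simp: L_lt R_gt DL)
    finally show ?thesis by (simp add: DL)
  qed
  have ne: "S1 \<noteq> {}" "S2 \<noteq> {}" using m by auto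
  have c_nonneg: "c \<ge> 0"
  proof -
    obtain x y where "x \<in> S1" "y \<in> S2" using ne by auto
    then have "X x \<in> {\<alpha><..<\<beta>}" "X y \<in> {\<alpha><..<\<beta>}" "\<tau> \<le> \<bar>X x - X y\<bar>" using range sep by auto
    then show ?thesis using \<open>0 < \<tau>\<close> by (auto simp: c_def)
  qed
  have gap_B: "AE x in M. X x \<in> {s..s+\<tau>} \<longrightarrow> x \<in> B" if "gap s" for s
  proof -
    have "measure D ({s} \<union> {s + \<tau>}) = 0"
      using D.finite_measure_Union[of "{s}" "{s + \<tau>}"] atom \<open>0 < \<tau>\<close> by (auto simp: Dd)
    then have "emeasure D {s, s + \<tau>} = 0"
      unfolding D.emeasure_eq_measure by (simp add: insert_is_Un[of s "{s+\<tau>}"])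
    then have "AE x in D. x \<notin> {s, s + \<tau>}" by (intro AE_not_in null_setsI) (auto simp: Dd)
    then have "AE x in M. X x \<notin> {s, s + \<tau>}" unfolding D_def by (subst (asm) AE_distr_iff) auto
    then show ?thesis using cover
    proof eventually_elim
      case (elim x)
      then show ?case using that by (force simp: gap_def T1_def T2_def disjoint_iff)
    qed
  qed
  have one_gap: "measure D {s..s+\<tau>} \<le> measure M B" if "gap s" for s
    using gap_B[OF that] by (subst DM) (auto intro!: finite_measure_mono_AE elim: eventually_mono)
  have two_gaps: "measure D {s..s+\<tau>} + measure D {r..r+\<tau>} \<le> measure M B"
    if "gap s" "gap r" "s + \<tau> \<le> r" for s r
  proof -
    \<comment> \<open>The two windows may touch at \<open>r = s + \<tau>\<close>, so the null point
      \<open>r\<close> is removed before the masses are added.\<close>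
    have "{r..r+\<tau>} = {r<..r+\<tau>} \<union> {r}" using \<open>0 < \<tau>\<close> by auto
    then have "measure D {s..s+\<tau>} + measure D {r..r+\<tau>} = measure D {s..s+\<tau>} + (measure D {r<..r+\<tau>} + measure D {r})"
      by (simp only:) (subst D.finite_measure_Union, auto simp: Dd)
    also have "\<dots> = measure D ({s..s+\<tau>} \<union> {r<..r+\<tau>})"
      using that by (subst D.finite_measure_Union) (auto simp: D.M_is_borel atom)
    also have "\<dots> \<le> measure M B"
      using AE_conjI[OF gap_B[OF that(1)] gap_B[OF that(2)]]
      by (subst DM) (auto intro!: finite_measure_mono_AE elim: eventually_mono)
    finally show ?thesis .
  qed
  have done_if: ?thesis if s: "gap s" "m \<le> L s" "m \<le> R s" for s
  proof -
    have "m * G (\<sigma> / m) \<le> c * measure D {s..s+\<tau>}" using s \<sigma> m by (intro window) auto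
    also have "\<dots> \<le> c * measure M B" by (intro mult_left_mono one_gap c_nonneg s)
    finally show ?thesis by (simp add: \<sigma>_def c_def)
  qed
  have Lzero: "L s = 0" if "s \<le> \<alpha>" for s
    unfolding L_def using that
    by (simp add: DL set_lebesgue_integral_def, intro integral_eq_zero_AE) (auto simp: indicator_def zero)
  have Rzero: "R s = 0" if "s \<ge> \<beta>" for s
    unfolding R_def using that \<open>0 < \<tau>\<close>
    by (simp add: DL set_lebesgue_integral_def, intro integral_eq_zero_AE) (auto simp: indicator_def zero)
  \<comment> \<open>At position \<open>\<alpha> - \<tau>\<close> there is no mass on the left, at
    \<open>\<beta>\<close> none on the right, and both are gaps because the images of the sets lie
    strictly between \<open>\<alpha>\<close> and \<open>\<beta>\<close>. So \<open>PL\<close> and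
    \<open>PR\<close> are nonempty.\<close>
  define PL where "PL = {s. gap s} \<inter> {s. L s \<le> R s} \<inter> {\<alpha>-\<tau>..\<beta>}"
  define PR where "PR = {s. gap s} \<inter> {s. R s \<le> L s} \<inter> {\<alpha>-\<tau>..\<beta>}"
  have cLR: "continuous_on UNIV L" "continuous_on UNIV R"
    using contL contR by (auto simp: continuous_on_eq_continuous_at)
  have compact: "compact PL" "compact PR" unfolding PL_def PR_def
    by (intro closed_Int_compact closed_Int closed_gap closed_Collect_le cLR compact_Icc)+
  obtain x0 where x0: "x0 \<in> S1" using ne by auto
  have \<alpha>\<beta>: "\<alpha> < \<beta>" using range x0 by force
  have "gap (\<alpha> - \<tau>)" "gap \<beta>" using range by (auto simp: gap_def T1_def T2_def)
  then have "\<alpha> - \<tau> \<in> PL" "\<beta> \<in> PR"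
    using \<alpha>\<beta> \<open>0 < \<tau>\<close> by (auto simp: PL_def PR_def Lzero Rzero) (auto simp: L_def R_def)
  then obtain p r where p: "p \<in> PL" "\<And>s. s \<in> PL \<Longrightarrow> s \<le> p" and r: "r \<in> PR" "\<And>s. s \<in> PR \<Longrightarrow> r \<le> s"
    using compact_attains_sup[OF compact(1)] compact_attains_inf[OF compact(2)] by (metis empty_iff)
  have gp: "gap p" "L p \<le> R p" "gap r" "R r \<le> L r" "\<alpha> - \<tau> \<le> p" "p \<le> \<beta>" "\<alpha> - \<tau> \<le> r" "r \<le> \<beta>"
    using p r by (auto simp: PL_def PR_def)
  \<comment> \<open>Equal sides have mass at least \<open>\<sigma> / 2\<close>, hence at least
    \<open>m\<close>, so the bound for one gap applies.\<close>
  have balanced: ?thesis if "gap s" "L s = R s" for s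
    using done_if[of s] that total[of s] \<sigma> by auto
  show ?thesis
  proof (cases "m \<le> L p \<or> m \<le> R r")
    case True
    then show ?thesis using done_if[of p] done_if[of r] gp by auto
  next
    case False
    show ?thesis
    proof (cases "p + \<tau> \<le> r")
      case overlap: False
      show ?thesis
      proof (cases "r \<le> p")
        case True
        \<comment> \<open>The chain is
          \<open>L r \<le> L p \<le> R p \<le> R r \<le> L r\<close>.\<close>
        then have "L r = R r" using Lmono[OF True] Rmono[OF True] gp by auto
        then show ?thesis using balanced gp by auto
      next
        case False
        \<comment> \<open>The windows at \<open>p\<close> and \<open>r\<close> overlap, so a window
          starting between them is covered by the two gaps, the point \<open>r\<close> itself lying
          inside the first. A balanced position found by continuity is therefore a gap.\<close>
        have "\<exists>s\<ge>p. s \<le> r \<and> L s - R s = 0"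
          using gp False by (intro IVT) (auto intro!: continuous_intros contL contR)
        then obtain s where s: "p \<le> s" "s \<le> r" "L s = R s" by auto
        have "{s<..<s+\<tau>} \<subseteq> {p<..<p+\<tau>} \<union> {r<..<r+\<tau>} \<union> {r}" using s overlap by auto
        moreover have "r \<in> {p<..<p+\<tau>}" using False overlap by auto
        ultimately have "gap s" using gp(1,3) unfolding gap_def by blast
        then show ?thesis using balanced s by auto
      qed
    next
      case apart: True
      \<comment> \<open>Otherwise \<open>exists_gap\<close> produces a gap strictly between
        \<open>p\<close> and \<open>r\<close>. It belongs to \<open>PL\<close> or to
        \<open>PR\<close>, against the extremality of \<open>p\<close> or of
        \<open>r\<close>.\<close>
      have "T1 \<inter> {p+\<tau>..r} = {} \<or> T2 \<inter> {p+\<tau>..r} = {}"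
      proof (rule ccontr)
        assume "\<not> ?thesis"
        then obtain x1 x2 where x: "x1 \<in> T1" "x2 \<in> T2" "x1 \<in> {p+\<tau>..r}" "x2 \<in> {p+\<tau>..r}" by blast
        have sep': "\<tau> \<le> \<bar>x - y\<bar>" if "x \<in> T1" "y \<in> T2" for x y
          using sep that by (auto simp: T1_def T2_def)
        have "\<exists>s. p < s \<and> s < r \<and> gap s"
        proof (cases "x1 < x2")
          case True
          obtain s where "x1 \<le> s" "s + \<tau> \<le> x2" "{s<..<s+\<tau>} \<inter> (T1 \<union> T2) = {}"
            using exists_gap[of T1 T2 \<tau> x1 x2] sep' x True by blast
          then show ?thesis using x \<open>0 < \<tau>\<close> by (intro exI[of _ s]) (auto simp: gap_def)
        next
          case False
          then have "x2 < x1" using sep'[OF x(1,2)] \<open>0 < \<tau>\<close> by auto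
          moreover have "\<tau> \<le> \<bar>y - x\<bar>" if "x \<in> T1" "y \<in> T2" for x y
            using sep'[OF that] by (simp add: abs_minus_commute)
          ultimately obtain s where "x2 \<le> s" "s + \<tau> \<le> x1" "{s<..<s+\<tau>} \<inter> (T2 \<union> T1) = {}"
            using exists_gap[of T2 T1 \<tau> x2 x1] x by blast
          then show ?thesis using x \<open>0 < \<tau>\<close> by (intro exI[of _ s]) (auto simp: gap_def)
        qed
        then obtain s where s: "p < s" "s < r" "gap s" by auto
        then have "s \<in> PL \<or> s \<in> PR" using gp by (auto simp: PL_def PR_def)
        then show False using p(2)[of s] r(2)[of s] s by auto
      qed
      then have disjoint: "X ` S1 \<inter> {p+\<tau>..r} = {} \<or> X ` S2 \<inter> {p+\<tau>..r} = {}"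
        unfolding T1_def T2_def .
      have away: "X ` S \<subseteq> {..p} \<union> {r+\<tau>..}"
        if "S = S1 \<or> S = S2" "(X ` S) \<inter> {p+\<tau>..r} = {}" for S
      proof
        fix x assume x: "x \<in> X ` S"
        then have "x \<notin> {p<..<p+\<tau>}" "x \<notin> {r<..<r+\<tau>}" "x \<notin> {p+\<tau>..r}"
          using gp(1,3) that unfolding gap_def T1_def T2_def by blast+
        then show "x \<in> {..p} \<union> {r+\<tau>..}" by auto
      qed
      have "measure M S \<le> L p + R r"
        if "S = S1 \<or> S = S2" "X ` S \<inter> {p+\<tau>..r} = {}" for S
        using outer[OF _ away[OF that]] that(1) sets by blast
      then have "measure M S1 \<le> L p + R r \<or> measure M S2 \<le> L p + R r"
        using disjoint by blast
      then have lr: "m \<le> L p + R r" unfolding m(1) by linarith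
      have pos: "0 < L p" "0 < R r" using lr False by auto
      \<comment> \<open>By the choice of \<open>p\<close> and \<open>r\<close> the lighter sides are
        \<open>L p\<close> and \<open>R r\<close>. Each is below \<open>m\<close> in this case, but
        the two outer regions together contain the whole image of one of the sets.\<close>
      have "m * G (\<sigma> / m) \<le> L p * G (\<sigma> / L p) + R r * G (\<sigma> / R r)"
        using pos lr False \<sigma> m by (intro profile_subadd) auto
      also have "\<dots> \<le> c * measure D {p..p+\<tau>} + c * measure D {r..r+\<tau>}"
        using pos False \<sigma> gp by (intro add_mono window) auto
      also have "\<dots> = c * (measure D {p..p+\<tau>} + measure D {r..r+\<tau>})" by (simp add: algebra_simps)
      also have "\<dots> \<le> c * measure M B" by (intro mult_left_mono two_gaps c_nonneg gp apart)
      finally show ?thesis by (simp add: \<sigma>_def c_def)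
    qed
  qed
qed

end

section \<open>Prekopa's theorem and coordinate marginals\<close>

text \<open>The layer-cake formula with levels written as \<open>u * c\<close> for \<open>u\<close>
  between 0 and 1, so that functions with different suprema can be compared at the same relative
  level \<open>u\<close>. The truncation at \<open>c\<close> changes nothing if \<open>c\<close>
  bounds \<open>f\<close>, and is harmless where the integral is only bounded from below.\<close>

lemma nn_integral_layers:
  fixes f :: "real \<Rightarrow> real"
  assumes [measurable]: "f \<in> borel_measurable borel" and "\<And>x. 0 \<le> f x" "0 < c"
  shows "(\<integral>\<^sup>+ x. ennreal (min c (f x)) \<partial>lborel)
    = ennreal c * (\<integral>\<^sup>+ u. indicator {0<..<1} u * emeasure lborel {x. u * c < f x} \<partial>lborel)"
proof -
  have "(\<integral>\<^sup>+ u. indicator {0<..<1} u * emeasure lborel {x. u * c < f x} \<partial>lborel)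
      = (\<integral>\<^sup>+ u. (\<integral>\<^sup>+ x. indicator {0<..<1} u * indicator {x. u * c < f x} x \<partial>lborel) \<partial>lborel)"
    by (subst nn_integral_cmult) auto
  also have "\<dots> = (\<integral>\<^sup>+ x. (\<integral>\<^sup>+ u. indicator {0<..<1} u * indicator {x. u * c < f x} x \<partial>lborel) \<partial>lborel)"
    by (rule lborel_pair.Fubini') simp
  also have "\<dots> = (\<integral>\<^sup>+ x. ennreal (min c (f x) / c) \<partial>lborel)"
  proof (rule nn_integral_cong)
    fix x
    have "(\<integral>\<^sup>+ u. indicator {0<..<1} u * indicator {x. u * c < f x} x \<partial>lborel)
        = (\<integral>\<^sup>+ u. indicator {0<..<min c (f x) / c} u \<partial>lborel)"
    proof (intro nn_integral_cong)
      fix u :: real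
      have "u * c < f x \<and> u < 1 \<longleftrightarrow> u * c < min c (f x)"
        using mult_less_cancel_right_pos[OF \<open>0 < c\<close>, of u 1] by auto
      also have "\<dots> \<longleftrightarrow> u < min c (f x) / c" using \<open>0 < c\<close> by (simp only: pos_less_divide_eq)
      finally show "indicator {0<..<1} u * indicator {x. u * c < f x} x
          = (indicator {0<..<min c (f x) / c} u :: ennreal)"
        by (auto simp: indicator_def)
    qed
    also have "\<dots> = ennreal (min c (f x) / c)" using assms by simp
    finally show "(\<integral>\<^sup>+ u. indicator {0<..<1} u * indicator {x. u * c < f x} x \<partial>lborel) = ennreal (min c (f x) / c)" .
  qed
  also have "ennreal c * \<dots> = (\<integral>\<^sup>+ x. ennreal (min c (f x)) \<partial>lborel)"
    using assms by (subst nn_integral_cmult[symmetric]) (auto simp flip: ennreal_mult)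
  finally show ?thesis by simp
qed

text \<open>The Brunn-Minkowski inequality for bounded intervals: a length is supremum minus
  infimum, and both are additive under \<open>t * a + (1 - t) * b\<close>. The open interval between
  the combined end points already has the required length.\<close>

lemma emeasure_interval_combination:
  fixes A B C :: "real set"
  assumes A: "convex A" "A \<noteq> {}" "bounded A" and B: "convex B" "B \<noteq> {}" "bounded B"
    and C: "C \<in> sets borel" and t: "0 < t" "t < 1"
    and sub: "\<And>a b. a \<in> A \<Longrightarrow> b \<in> B \<Longrightarrow> t * a + (1 - t) * b \<in> C"
  shows "ennreal t * emeasure lborel A + ennreal (1 - t) * emeasure lborel B \<le> emeasure lborel C"
proof -
  have bA: "bdd_above A" "bdd_below A" and bB: "bdd_above B" "bdd_below B"
    using A B bounded_imp_bdd_above bounded_imp_bdd_below by auto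
  define i j where "i = t * Inf A + (1 - t) * Inf B" and "j = t * Sup A + (1 - t) * Sup B"
  define E where "E = (\<Union>a\<in>A. \<Union>b\<in>B. {t * a + (1 - t) * b})"
  have "E = (\<Union>x\<in>(*) t ` A. \<Union>y\<in>(*) (1 - t) ` B. {x + y})" by (auto simp: E_def)
  moreover have "convex ((*) t ` A)" "convex ((*) (1 - t) ` B)"
    using convex_scaling[OF A(1), of t] convex_scaling[OF B(1), of "1 - t"] by auto
  ultimately have "convex E" using convex_sums[of "(*) t ` A" "(*) (1 - t) ` B"] by metis
  \<comment> \<open>\<open>E\<close> is an interval, so one combination below \<open>z\<close> and
    one above are enough; points close to the infima and to the suprema supply them.\<close>
  have "z \<in> E" if z: "i < z" "z < j" for z
  proof -
    have "Inf A < Inf A + (z - i)" "Inf B < Inf B + (z - i)" using z by auto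
    then obtain a b where ab: "a \<in> A" "b \<in> B" "a < Inf A + (z - i)" "b < Inf B + (z - i)"
      using cInf_lessD[OF A(2)] cInf_lessD[OF B(2)] by metis
    have "t * a + (1 - t) * b < t * (Inf A + (z - i)) + (1 - t) * (Inf B + (z - i))"
      using ab t by (intro add_strict_mono mult_strict_left_mono) auto
    then have lo: "t * a + (1 - t) * b < z" by (simp add: i_def algebra_simps)
    have "Sup A - (j - z) < Sup A" "Sup B - (j - z) < Sup B" using z by auto
    then obtain a' b' where ab': "a' \<in> A" "b' \<in> B" "Sup A - (j - z) < a'" "Sup B - (j - z) < b'"
      using less_cSupD[OF A(2)] less_cSupD[OF B(2)] by metis
    have "t * (Sup A - (j - z)) + (1 - t) * (Sup B - (j - z)) < t * a' + (1 - t) * b'"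
      using ab' t by (intro add_strict_mono mult_strict_left_mono) auto
    then have hi: "z < t * a' + (1 - t) * b'" by (simp add: j_def algebra_simps)
    have "t * a + (1 - t) * b \<in> E" "t * a' + (1 - t) * b' \<in> E" using ab ab' by (auto simp: E_def)
    moreover have "is_interval E" using \<open>convex E\<close> unfolding is_interval_convex_1 .
    ultimately show ?thesis using lo hi by (meson less_imp_le mem_is_interval_1_I)
  qed
  moreover have "E \<subseteq> C" using sub by (auto simp: E_def)
  ultimately have "{i<..<j} \<subseteq> C" by auto
  have "A \<subseteq> {Inf A..Sup A}" using bA by (auto intro: cInf_lower cSup_upper)
  then have eA: "emeasure lborel A \<le> ennreal (Sup A - Inf A)"
    using emeasure_mono[of A "{Inf A..Sup A}" lborel] cInf_le_cSup[OF A(2) bA] by simp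
  have "B \<subseteq> {Inf B..Sup B}" using bB by (auto intro: cInf_lower cSup_upper)
  then have eB: "emeasure lborel B \<le> ennreal (Sup B - Inf B)"
    using emeasure_mono[of B "{Inf B..Sup B}" lborel] cInf_le_cSup[OF B(2) bB] by simp
  have le: "Inf A \<le> Sup A" "Inf B \<le> Sup B" using cInf_le_cSup[OF A(2) bA] cInf_le_cSup[OF B(2) bB] .
  have "ennreal t * emeasure lborel A + ennreal (1 - t) * emeasure lborel B
      \<le> ennreal t * ennreal (Sup A - Inf A) + ennreal (1 - t) * ennreal (Sup B - Inf B)"
    by (intro add_mono mult_left_mono eA eB) auto
  also have "\<dots> = ennreal (t * (Sup A - Inf A) + (1 - t) * (Sup B - Inf B))" using t le
    by (simp flip: ennreal_mult ennreal_plus)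
  also have "t * (Sup A - Inf A) + (1 - t) * (Sup B - Inf B) = j - i"
    by (simp add: i_def j_def algebra_simps)
  also have "\<dots> = emeasure lborel {i<..<j}"
  proof -
    have "i \<le> j" unfolding i_def j_def using t le by (intro add_mono mult_left_mono) auto
    then show ?thesis by simp
  qed
  also have "\<dots> \<le> emeasure lborel C" using \<open>{i<..<j} \<subseteq> C\<close> C by (intro emeasure_mono) auto
  finally show ?thesis .
qed

lemma convex_superlevel_log_concave:
  assumes "log_concave f" "0 \<le> c"
  shows "convex {x. c < f x}"
proof (rule convexI)
  fix x y and u v :: real
  assume xy: "x \<in> {x. c < f x}" "y \<in> {x. c < f x}" and uv: "0 \<le> u" "0 \<le> v" "u + v = 1"
  define m where "m = min (f x) (f y)"
  have m: "c < m" "0 < m" using xy assms by (auto simp: m_def)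
  have "m = m powr u * m powr v" using m uv by (simp flip: powr_add)
  also have "\<dots> \<le> f x powr u * f y powr v"
    using m uv by (intro mult_mono powr_mono2) (auto simp: m_def)
  also have "\<dots> \<le> f (u *\<^sub>R x + v *\<^sub>R y)"
  proof -
    have v: "v = 1 - u" using uv by simp
    show ?thesis using assms(1) uv unfolding log_concave_def v by auto
  qed
  finally show "u *\<^sub>R x + v *\<^sub>R y \<in> {x. c < f x}" using m by simp
qed

text \<open>Superlevel sets of log-concave functions are intervals, so only lengths have to be
  compared. Scaling \<open>f\<close> and \<open>g\<close> each by its own supremum keeps both
  superlevel sets nonempty at every level below 1; integration over the levels gives a bound by an
  arithmetic mean, which dominates the geometric mean in the claim.\<close>

lemma prekopa_leindler_real:
  fixes f g h :: "real \<Rightarrow> real"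
  assumes lc: "log_concave f" "log_concave g" and h0: "\<And>x. 0 \<le> h x"
    and int: "integrable lborel f" "integrable lborel g" "integrable lborel h"
    and bdd: "bdd_above (range f)" "bdd_above (range g)"
    and supp: "bounded {x. 0 < f x}" "bounded {x. 0 < g x}"
    and t: "0 < t" "t < 1"
    and le: "\<And>x y. f x powr t * g y powr (1 - t) \<le> h (t * x + (1 - t) * y)"
  shows "(LINT x|lborel. f x) powr t * (LINT x|lborel. g x) powr (1 - t) \<le> (LINT x|lborel. h x)"
proof -
  have nn: "0 \<le> f x" "0 \<le> g x" for x using lc by (auto simp: log_concave_def)
  define P Q where "P = (LINT x|lborel. f x)" and "Q = (LINT x|lborel. g x)"
  have PQ0: "0 \<le> P" "0 \<le> Q" using nn by (auto simp: P_def Q_def)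
  have hint: "0 \<le> (LINT x|lborel. h x)" using h0 by simp
  show ?thesis
  proof (cases "P = 0 \<or> Q = 0")
    case True
    then show ?thesis using hint t unfolding P_def Q_def by auto
  next
    case False
    then have PQ: "P > 0" "Q > 0" using PQ0 by auto
    have [measurable]: "f \<in> borel_measurable borel" "g \<in> borel_measurable borel" "h \<in> borel_measurable borel"
      using int by auto
    define a b where "a = Sup (range f)" and "b = Sup (range g)"
    have fa: "f x \<le> a" "g x \<le> b" for x
      unfolding a_def b_def using bdd by (auto intro: cSup_upper)
    have "f \<noteq> (\<lambda>x. 0)" "g \<noteq> (\<lambda>x. 0)" using PQ by (auto simp: P_def Q_def)
    then obtain x y where "f x \<noteq> 0" "g y \<noteq> 0" by (meson ext)
    then have ab: "a > 0" "b > 0" using fa[of x] fa[of y] nn[of x] nn[of y] by linarith+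
    \<comment> \<open>The level \<open>u * c\<close> of \<open>h\<close> matches
      \<open>u * a\<close> for \<open>f\<close> and \<open>u * b\<close> for \<open>g\<close>,
      because \<open>u = u powr t * u powr (1 - t)\<close>.\<close>
    define c where "c = a powr t * b powr (1 - t)"
    have c: "c > 0" using ab by (simp add: c_def)
    let ?A = "\<lambda>u. {x. u * a < f x}" and ?B = "\<lambda>u. {x. u * b < g x}" and ?H = "\<lambda>u. {x. u * c < h x}"
    have key: "ennreal t * emeasure lborel (?A u) + ennreal (1 - t) * emeasure lborel (?B u)
        \<le> emeasure lborel (?H u)" if u: "0 < u" "u < 1" for u
    proof (rule emeasure_interval_combination)
      show "convex (?A u)" "convex (?B u)"
        using u ab lc by (auto intro!: convex_superlevel_log_concave)
      have "u * a < Sup (range f)" "u * b < Sup (range g)"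
        using u ab by (simp_all flip: a_def b_def)
      then show "?A u \<noteq> {}" "?B u \<noteq> {}" using bdd by (auto simp: less_cSup_iff)
      have "0 < u * a" "0 < u * b" using u ab by auto
      then show "bounded (?A u)" "bounded (?B u)"
        by (auto intro: bounded_subset[OF supp(1)] bounded_subset[OF supp(2)])
      fix x y assume xy: "x \<in> ?A u" "y \<in> ?B u"
      have "u * c = (u powr t * u powr (1 - t)) * c" using u by (simp flip: powr_add)
      also have "\<dots> = (u * a) powr t * (u * b) powr (1 - t)"
        using u ab by (simp add: c_def powr_mult)
      also have "\<dots> < f x powr t * g y powr (1 - t)"
      proof (intro mult_strict_mono powr_less_mono2)
        have "0 < f x" using xy \<open>0 < u * a\<close> by auto
        then show "0 < f x powr t" by simp
      qed (use xy t \<open>0 < u * a\<close> \<open>0 < u * b\<close> in auto)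
      finally show "t * x + (1 - t) * y \<in> ?H u" using le[of x y] by simp
    qed (use t in auto)
    define IA IB where "IA = (\<integral>\<^sup>+ u. indicator {0<..<1} u * emeasure lborel (?A u) \<partial>lborel)"
      and "IB = (\<integral>\<^sup>+ u. indicator {0<..<1} u * emeasure lborel (?B u) \<partial>lborel)"
    have "ennreal P = (\<integral>\<^sup>+ x. ennreal (min a (f x)) \<partial>lborel)"
      unfolding P_def using int nn fa by (simp add: nn_integral_eq_integral min_absorb2)
    then have P: "ennreal P = ennreal a * IA"
      unfolding IA_def using nn_integral_layers[of f a] nn ab by auto
    have "ennreal Q = (\<integral>\<^sup>+ x. ennreal (min b (g x)) \<partial>lborel)"
      unfolding Q_def using int nn fa by (simp add: nn_integral_eq_integral min_absorb2)
    then have Q: "ennreal Q = ennreal b * IB"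
      unfolding IB_def using nn_integral_layers[of g b] nn ab by auto
    have IA: "IA = ennreal (P / a)"
    proof -
      have "ennreal (1 / a) * (ennreal a * IA) = IA"
        using ab by (simp add: mult.assoc[symmetric] flip: ennreal_mult)
      then show ?thesis using ab PQ unfolding P[symmetric] by (simp flip: ennreal_mult)
    qed
    have IB: "IB = ennreal (Q / b)"
    proof -
      have "ennreal (1 / b) * (ennreal b * IB) = IB"
        using ab by (simp add: mult.assoc[symmetric] flip: ennreal_mult)
      then show ?thesis using ab PQ unfolding Q[symmetric] by (simp flip: ennreal_mult)
    qed
    have meas: "(\<lambda>u. emeasure lborel {x. u * k < F x}) \<in> borel_measurable lborel"
      if [measurable]: "F \<in> borel_measurable borel" for F :: "real \<Rightarrow> real" and k
    proof -
      have "(\<lambda>u. \<integral>\<^sup>+ x. indicator {x. u * k < F x} x \<partial>lborel) \<in> borel_measurable lborel"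
        by (rule lborel.borel_measurable_nn_integral) simp
      then show ?thesis by simp
    qed
    note [measurable] = meas[of f a] meas[of g b] meas[of h c]
    have "ennreal (t * (P / a) + (1 - t) * (Q / b)) = ennreal t * IA + ennreal (1 - t) * IB"
      using t ab PQ by (simp add: IA IB flip: ennreal_mult ennreal_plus)
    also have "\<dots> = (\<integral>\<^sup>+ u. indicator {0<..<1} u *
        (ennreal t * emeasure lborel (?A u) + ennreal (1 - t) * emeasure lborel (?B u)) \<partial>lborel)"
      unfolding IA_def IB_def
      by (subst (1 2) nn_integral_cmult[symmetric], simp, simp, subst nn_integral_add[symmetric])
        (auto simp: distrib_left mult_ac intro!: nn_integral_cong)
    also have "\<dots> \<le> (\<integral>\<^sup>+ u. indicator {0<..<1} u * emeasure lborel (?H u) \<partial>lborel)"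
      using key by (intro nn_integral_mono) (auto simp: indicator_def)
    finally have "ennreal c * ennreal (t * (P / a) + (1 - t) * (Q / b))
        \<le> ennreal c * (\<integral>\<^sup>+ u. indicator {0<..<1} u * emeasure lborel (?H u) \<partial>lborel)"
      by (intro mult_left_mono) auto
    also have "\<dots> = (\<integral>\<^sup>+ x. ennreal (min c (h x)) \<partial>lborel)"
      using nn_integral_layers[of h c] h0 c by simp
    also have "\<dots> \<le> (\<integral>\<^sup>+ x. ennreal (h x) \<partial>lborel)"
      by (intro nn_integral_mono) (auto simp: ennreal_leI)
    also have "\<dots> = ennreal (LINT x|lborel. h x)" using int h0 by (simp add: nn_integral_eq_integral)
    finally have fin: "c * (t * (P / a) + (1 - t) * (Q / b)) \<le> (LINT x|lborel. h x)"
      using c hint by (simp flip: ennreal_mult')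
    have "P powr t * Q powr (1 - t) = c * ((P / a) powr t * (Q / b) powr (1 - t))"
      using PQ ab by (simp add: c_def powr_divide)
    also have "\<dots> \<le> c * (t * (P / a) + (1 - t) * (Q / b))"
      using c t PQ ab by (intro mult_left_mono Youngs_inequality_0) auto
    finally show ?thesis using fin unfolding P_def Q_def by linarith
  qed
qed

text \<open>The marginal is kept as a function on the whole space, constant along \<open>b\<close>,
  so that the construction can be iterated without changing the type. Log-concavity is the
  Prekopa-Leindler inequality for the fibres through \<open>x\<close>, \<open>y\<close> and their
  combination; the support bound makes the fibres integrable, and the last conclusion hands it on to
  the other coordinates.\<close>

lemma log_concave_marginal:
  fixes F :: "'a::euclidean_space \<Rightarrow> real" and b :: 'a
  assumes lc: "log_concave F" and [measurable]: "F \<in> borel_measurable borel"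
    and bound: "\<And>x. F x \<le> C" and b: "b \<in> Basis"
    and supp: "\<And>x. F x \<noteq> 0 \<Longrightarrow> \<bar>x \<bullet> b\<bar> \<le> \<rho>"
  defines "F' \<equiv> \<lambda>x. LINT r|lborel. F (x + (r - x \<bullet> b) *\<^sub>R b)"
  shows "log_concave F'" "F' \<in> borel_measurable borel" "\<exists>C'. \<forall>x. F' x \<le> C'"
    "ennreal (F' x) = (\<integral>\<^sup>+ r. ennreal (F (x + (r - x \<bullet> b) *\<^sub>R b)) \<partial>lborel)"
    "c \<in> Basis \<Longrightarrow> c \<noteq> b \<Longrightarrow> (\<And>x. F x \<noteq> 0 \<Longrightarrow> \<bar>x \<bullet> c\<bar> \<le> \<rho>) \<Longrightarrow> F' x \<noteq> 0 \<Longrightarrow> \<bar>x \<bullet> c\<bar> \<le> \<rho>"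
proof -
  have nn: "F x \<ge> 0" for x using lc by (simp add: log_concave_def)
  define f where "f x r = F (x + (r - x \<bullet> b) *\<^sub>R b)" for x r
  have [measurable]: "f x \<in> borel_measurable borel" for x unfolding f_def by measurable
  have fC: "f x r \<le> C" "f x r \<ge> 0" for x r by (auto simp: f_def bound nn)
  have coord: "(x + (r - x \<bullet> b) *\<^sub>R b) \<bullet> b = r" for x r
    using b by (simp add: inner_add_left)
  have fsupp: "f x r \<noteq> 0 \<Longrightarrow> r \<in> {-\<rho>..\<rho>}" for x r
    using supp[of "x + (r - x \<bullet> b) *\<^sub>R b"] unfolding f_def coord by auto
  have C0: "C \<ge> 0" using nn bound order_trans by blast
  have ind: "f x r \<le> C * indicator {-\<rho>..\<rho>} r" for x r
    using fsupp[of x r] fC[of x r] C0 by (cases "f x r = 0") auto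
  have intC: "integrable lborel (\<lambda>r. C * indicator {-\<rho>..\<rho>} r)"
    by (intro integrable_mult_right integrable_real_indicator) (auto simp: emeasure_lborel_Icc_eq)
  have int: "integrable lborel (f x)" for x
    by (rule Bochner_Integration.integrable_bound[OF intC]) (use ind fC in \<open>auto intro: order_trans[OF _ abs_ge_self]\<close>)
  have F': "F' x = (LINT r|lborel. f x r)" for x by (simp add: F'_def f_def)
  have F'0: "F' x \<ge> 0" for x unfolding F' using fC by simp
  show "ennreal (F' x) = (\<integral>\<^sup>+ r. ennreal (F (x + (r - x \<bullet> b) *\<^sub>R b)) \<partial>lborel)"
    unfolding F' using nn_integral_eq_integral[OF int[of x]] fC by (simp add: f_def)
  show "F' \<in> borel_measurable borel" unfolding F'_def
    by (rule lborel.borel_measurable_lebesgue_integral) simp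
  have "F' x \<le> (LINT r|lborel. C * indicator {-\<rho>..\<rho>} r)" for x
    unfolding F' by (intro integral_mono int intC ind)
  then show "\<exists>C'. \<forall>x. F' x \<le> C'" by blast
  have comb: "F x powr t * F y powr (1 - t) \<le> F (t *\<^sub>R x + (1 - t) *\<^sub>R y)"
    if "0 \<le> t" "t \<le> 1" for x y t
    using lc that unfolding log_concave_def by blast
  have fcomb: "f x r powr t * f y r' powr (1 - t) \<le> f (t *\<^sub>R x + (1 - t) *\<^sub>R y) (t * r + (1 - t) * r')"
    if "0 \<le> t" "t \<le> 1" for x y r r' t
  proof -
    have "t *\<^sub>R (x + (r - x \<bullet> b) *\<^sub>R b) + (1 - t) *\<^sub>R (y + (r' - y \<bullet> b) *\<^sub>R b)
      = (t *\<^sub>R x + (1 - t) *\<^sub>R y) + ((t * r + (1 - t) * r') - (t *\<^sub>R x + (1 - t) *\<^sub>R y) \<bullet> b) *\<^sub>R b"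
      by (simp add: algebra_simps inner_add_left inner_diff_left)
    then show ?thesis unfolding f_def using comb[OF that, of "x + (r - x \<bullet> b) *\<^sub>R b" "y + (r' - y \<bullet> b) *\<^sub>R b"] by simp
  qed
  have flc: "log_concave (f x)" for x
    unfolding log_concave_def
  proof (intro conjI allI impI)
    fix r r' t :: real assume t: "0 \<le> t \<and> t \<le> 1"
    have "t *\<^sub>R x + (1 - t) *\<^sub>R x = x" by (simp flip: scaleR_add_left)
    then show "f x r powr t * f x r' powr (1 - t) \<le> f x (t *\<^sub>R r + (1 - t) *\<^sub>R r')"
      using fcomb[of t x r x r'] t by simp
  qed (use fC in auto)
  have main: "F' x powr t * F' y powr (1 - t) \<le> F' (t *\<^sub>R x + (1 - t) *\<^sub>R y)"
    if t: "0 < t" "t < 1" for x y t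
    unfolding F'
  proof (rule prekopa_leindler_real[OF flc flc _ int int int _ _ _ _ t])
    show "bdd_above (range (f x))" for x using fC by (auto intro!: bdd_aboveI)
    then show "bdd_above (range (f y))" .
    have "{r. 0 < f x r} \<subseteq> {-\<rho>..\<rho>}" for x using fsupp[of x] by force
    then show "bounded {r. 0 < f x r}" for x by (rule bounded_subset[OF bounded_closed_interval])
    then show "bounded {r. 0 < f y r}" .
  qed (use fC fcomb t in auto)
  show "log_concave F'"
    unfolding log_concave_def
  proof (intro conjI allI impI)
    fix x y and t :: real assume t: "0 \<le> t \<and> t \<le> 1"
    \<comment> \<open>At \<open>t = 0\<close> and \<open>t = 1\<close> one factor has exponent 0. It
      may be 0 as well as 1, because \<open>0 powr 0 = 0\<close>.\<close>
    have p0: "u powr 0 \<le> 1" for u :: real by (simp add: powr_def)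
    consider "t = 0" | "t = 1" | "0 < t" "t < 1" using t by linarith
    then show "F' x powr t * F' y powr (1 - t) \<le> F' (t *\<^sub>R x + (1 - t) *\<^sub>R y)"
    proof cases
      case 1 then show ?thesis using F'0[of y] mult_right_mono[OF p0[of "F' x"] F'0[of y]] by simp
    next
      case 2 then show ?thesis using F'0[of x] mult_left_mono[OF p0[of "F' y"] F'0[of x]] by simp
    qed (use main in auto)
  qed (rule F'0)
  assume c: "c \<in> Basis" "c \<noteq> b" and cs: "\<And>x. F x \<noteq> 0 \<Longrightarrow> \<bar>x \<bullet> c\<bar> \<le> \<rho>" and ne: "F' x \<noteq> 0"
  have "f x \<noteq> (\<lambda>r. 0)" using ne by (auto simp: F')
  then obtain r where "f x r \<noteq> 0" by (meson ext)
  then have "\<bar>(x + (r - x \<bullet> b) *\<^sub>R b) \<bullet> c\<bar> \<le> \<rho>" using cs by (simp add: f_def)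
  then show "\<bar>x \<bullet> c\<bar> \<le> \<rho>" using b c by (simp add: inner_add_left inner_not_same_Basis)
qed

section \<open>Integrating out all coordinates but one\<close>

lemma product_sigma_finite_lborel: "product_sigma_finite (\<lambda>_. lborel)"
  by (simp add: product_sigma_finite_def sigma_finite_lborel)

text \<open>Coordinates are integrated out one at a time. \<open>I\<close> collects those in which
  the support is known to be bounded: a marginal in direction \<open>a\<close> is constant along
  \<open>a\<close>, so \<open>a\<close> has to leave \<open>I\<close>.\<close>

lemma log_concave_iterated_marginal:
  fixes F :: "'a::euclidean_space \<Rightarrow> real"
  assumes "finite J" "J \<subseteq> I" "I \<subseteq> Basis"
    and "log_concave F" "F \<in> borel_measurable borel" "\<exists>C. \<forall>x. F x \<le> C"
    and "\<And>x b. b \<in> I \<Longrightarrow> F x \<noteq> 0 \<Longrightarrow> \<bar>x \<bullet> b\<bar> \<le> \<rho>"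
  shows "\<exists>F'. log_concave F' \<and> F' \<in> borel_measurable borel \<and>
    (\<forall>x b. b \<in> I - J \<longrightarrow> F' x \<noteq> 0 \<longrightarrow> \<bar>x \<bullet> b\<bar> \<le> \<rho>) \<and>
    (\<forall>x. ennreal (F' x) = (\<integral>\<^sup>+ y. ennreal (F ((\<Sum>b\<in>J. y b *\<^sub>R b) + (\<Sum>b\<in>Basis - J. (x \<bullet> b) *\<^sub>R b)))
        \<partial>Pi\<^sub>M J (\<lambda>_. lborel)))"
  using assms
proof (induction J arbitrary: F I rule: finite_induct)
  case empty
  have "emeasure (Pi\<^sub>M ({} :: 'a set) (\<lambda>_. lborel :: real measure)) (space (Pi\<^sub>M {} (\<lambda>_. lborel))) = 1"
    by (simp add: PiM_empty)
  with empty show ?case by (intro exI[of _ F]) (auto simp: euclidean_representation)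
next
  case (insert a J)
  obtain C where C: "\<And>x. F x \<le> C" using insert.prems(5) by blast
  have a: "a \<in> Basis" "a \<in> I" using insert by auto
  define F1 where "F1 x = (LINT r|lborel. F (x + (r - x \<bullet> a) *\<^sub>R a))" for x
  have sa: "F x \<noteq> 0 \<Longrightarrow> \<bar>x \<bullet> a\<bar> \<le> \<rho>" for x using insert.prems a by auto
  note F1 = log_concave_marginal[OF insert.prems(3,4) C a(1) sa, folded F1_def[abs_def]]
  note [measurable] = insert.prems(4)
  have "\<exists>F'. log_concave F' \<and> F' \<in> borel_measurable borel \<and>
      (\<forall>x b. b \<in> (I - {a}) - J \<longrightarrow> F' x \<noteq> 0 \<longrightarrow> \<bar>x \<bullet> b\<bar> \<le> \<rho>) \<and>
      (\<forall>x. ennreal (F' x) = (\<integral>\<^sup>+ y. ennreal (F1 ((\<Sum>b\<in>J. y b *\<^sub>R b) + (\<Sum>b\<in>Basis - J. (x \<bullet> b) *\<^sub>R b)))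
        \<partial>Pi\<^sub>M J (\<lambda>_. lborel)))"
  proof (rule insert.IH)
    fix x b assume b: "b \<in> I - {a}" and ne: "F1 x \<noteq> 0"
    show "\<bar>x \<bullet> b\<bar> \<le> \<rho>"
      by (rule F1(5)[of b x]) (use b ne[unfolded F1_def] insert.prems in auto)
  qed (use insert.prems insert.hyps F1(1,2) F1(3)[folded F1_def] in auto)
  then obtain F' where F': "log_concave F'" "F' \<in> borel_measurable borel"
    "\<And>x b. b \<in> I - {a} - J \<Longrightarrow> F' x \<noteq> 0 \<Longrightarrow> \<bar>x \<bullet> b\<bar> \<le> \<rho>"
    "\<And>x. ennreal (F' x) = (\<integral>\<^sup>+ y. ennreal (F1 ((\<Sum>b\<in>J. y b *\<^sub>R b) + (\<Sum>b\<in>Basis - J. (x \<bullet> b) *\<^sub>R b)))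
        \<partial>Pi\<^sub>M J (\<lambda>_. lborel))" by blast
  have "ennreal (F' x) = (\<integral>\<^sup>+ y. ennreal (F ((\<Sum>b\<in>insert a J. y b *\<^sub>R b) + (\<Sum>b\<in>Basis - insert a J. (x \<bullet> b) *\<^sub>R b)))
        \<partial>Pi\<^sub>M (insert a J) (\<lambda>_. lborel))" for x
  proof -
    \<comment> \<open>Moving a point along \<open>a\<close> to height \<open>r\<close> amounts to
      setting its coordinate \<open>a\<close> to \<open>r\<close>, which is the form of the product
      integral over \<open>insert a J\<close>.\<close>
    have eq: "ennreal (F1 ((\<Sum>b\<in>J. y b *\<^sub>R b) + (\<Sum>b\<in>Basis - J. (x \<bullet> b) *\<^sub>R b)))
      = (\<integral>\<^sup>+ r. ennreal (F ((\<Sum>b\<in>insert a J. (y(a := r)) b *\<^sub>R b) + (\<Sum>b\<in>Basis - insert a J. (x \<bullet> b) *\<^sub>R b))) \<partial>lborel)" for y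
    proof -
      define z where "z = (\<Sum>b\<in>J. y b *\<^sub>R b) + (\<Sum>b\<in>Basis - J. (x \<bullet> b) *\<^sub>R b)"
      have split: "(\<Sum>b\<in>Basis - J. (x \<bullet> b) *\<^sub>R b) = (x \<bullet> a) *\<^sub>R a + (\<Sum>b\<in>Basis - insert a J. (x \<bullet> b) *\<^sub>R b)"
        unfolding Diff_insert[of Basis a J] by (rule sum.remove) (use a insert.hyps in auto)
      have "b \<bullet> a = 0" if "b \<in> J \<union> (Basis - insert a J)" for b
        by (rule inner_not_same_Basis) (use that a(1) insert.hyps insert.prems(1,2) in auto)
      then have "z \<bullet> a = x \<bullet> a"
        unfolding z_def split inner_add_left inner_sum_left inner_scaleR_left using a(1) by simp
      moreover have "(\<Sum>b\<in>insert a J. (y(a := r)) b *\<^sub>R b) = r *\<^sub>R a + (\<Sum>b\<in>J. y b *\<^sub>R b)" for r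
        using insert.hyps by (auto intro!: sum.cong)
      ultimately have "z + (r - z \<bullet> a) *\<^sub>R a =
        (\<Sum>b\<in>insert a J. (y(a := r)) b *\<^sub>R b) + (\<Sum>b\<in>Basis - insert a J. (x \<bullet> b) *\<^sub>R b)" for r
        by (simp add: z_def split algebra_simps)
      then show ?thesis using F1(4)[of z, folded F1_def] by (simp add: z_def)
    qed
    show ?thesis unfolding F'(4) eq using insert.hyps
      by (subst product_sigma_finite.product_nn_integral_insert[OF product_sigma_finite_lborel]) auto
  qed
  then show ?case using F' by (intro exI[of _ F']) auto
qed

text \<open>The density at \<open>r\<close> is the integral of \<open>F\<close> over the slice with
  \<open>k\<close>-coordinate \<open>r\<close>: the marginal over the other coordinates, evaluated
  at \<open>r *\<^sub>R k\<close>. The last property carries a strip containing the support of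
  \<open>F\<close> over to the line.\<close>

lemma log_concave_coordinate_density:
  fixes F :: "'a::euclidean_space \<Rightarrow> real"
  assumes lc: "log_concave F" and [measurable]: "F \<in> borel_measurable borel"
    and "\<exists>C. \<forall>x. F x \<le> C" and supp: "bounded {x. F x \<noteq> 0}" and k: "k \<in> Basis"
  obtains f where "log_concave f" "f \<in> borel_measurable borel"
    "distr (density lebesgue (\<lambda>x. ennreal (F x))) borel (\<lambda>x. x \<bullet> k) = density lborel (\<lambda>r. ennreal (f r))"
    "\<And>r. (\<And>x. x \<bullet> k = r \<Longrightarrow> F x = 0) \<Longrightarrow> f r = 0"
proof -
  obtain \<rho> where \<rho>: "\<And>x. F x \<noteq> 0 \<Longrightarrow> norm x \<le> \<rho>" using supp by (auto simp: bounded_iff)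
  have coord: "\<bar>x \<bullet> b\<bar> \<le> \<rho>" if "b \<in> Basis" "F x \<noteq> 0" for x b
    using Basis_le_norm[OF that(1), of x] \<rho>[OF that(2)] by linarith
  obtain F' where F': "log_concave F'" "F' \<in> borel_measurable borel"
    "\<And>x. ennreal (F' x) = (\<integral>\<^sup>+ y. ennreal (F ((\<Sum>b\<in>Basis - {k}. y b *\<^sub>R b) + (\<Sum>b\<in>Basis - (Basis - {k}). (x \<bullet> b) *\<^sub>R b)))
        \<partial>Pi\<^sub>M (Basis - {k}) (\<lambda>_. lborel))"
    using log_concave_iterated_marginal[of "Basis - {k}" Basis F \<rho>] assms coord by auto
  note [measurable] = F'(2)
  have k': "Basis - (Basis - {k}) = {k}" using k by auto
  define f where "f r = F' (r *\<^sub>R k)" for r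
  have f: "ennreal (f r) = (\<integral>\<^sup>+ y. ennreal (F ((\<Sum>b\<in>Basis - {k}. y b *\<^sub>R b) + r *\<^sub>R k)) \<partial>Pi\<^sub>M (Basis - {k}) (\<lambda>_. lborel))" for r
    unfolding f_def F'(3) using k by (simp add: k')
  have [measurable]: "f \<in> borel_measurable borel" unfolding f_def by simp
  have "log_concave f"
    unfolding log_concave_def f_def
  proof (intro conjI allI impI)
    fix r r' t :: real assume t: "0 \<le> t \<and> t \<le> 1"
    have "t *\<^sub>R r *\<^sub>R k + (1 - t) *\<^sub>R r' *\<^sub>R k = (t *\<^sub>R r + (1 - t) *\<^sub>R r') *\<^sub>R k"
      by (simp add: scaleR_add_left)
    then show "F' (r *\<^sub>R k) powr t * F' (r' *\<^sub>R k) powr (1 - t) \<le> F' ((t *\<^sub>R r + (1 - t) *\<^sub>R r') *\<^sub>R k)"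
      using F'(1) t unfolding log_concave_def by metis
  qed (use F'(1) in \<open>auto simp: log_concave_def\<close>)
  moreover have "distr (density lebesgue (\<lambda>x. ennreal (F x))) borel (\<lambda>x. x \<bullet> k) = density lborel (\<lambda>r. ennreal (f r))"
  proof (rule measure_eqI)
    fix A assume "A \<in> sets (distr (density lebesgue (\<lambda>x. ennreal (F x))) borel (\<lambda>x. x \<bullet> k))"
    then have A[measurable]: "A \<in> sets borel" by simp
    have [measurable]: "F \<in> borel_measurable lebesgue" "(\<lambda>x. x \<bullet> k) \<in> borel_measurable lebesgue"
      by (auto intro: measurable_completion)
    have sb: "(\<lambda>x. x \<bullet> k) -` A \<inter> space lborel \<in> sets lborel" by measurable
    then have sl: "(\<lambda>x. x \<bullet> k) -` A \<in> sets lebesgue" by auto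
    have "emeasure (distr (density lebesgue (\<lambda>x. ennreal (F x))) borel (\<lambda>x. x \<bullet> k)) A
        = (\<integral>\<^sup>+ x. ennreal (F x) * indicator ((\<lambda>x. x \<bullet> k) -` A) x \<partial>lebesgue)"
      using sl by (subst emeasure_distr) (auto simp: emeasure_density)
    also have "\<dots> = (\<integral>\<^sup>+ x. ennreal (F x) * indicator A (x \<bullet> k) \<partial>lborel)"
      by (subst nn_integral_completion) (auto simp: indicator_def intro!: nn_integral_cong)
    also have "\<dots> = (\<integral>\<^sup>+ y. ennreal (F (\<Sum>b\<in>Basis. y b *\<^sub>R b)) * indicator A (y k) \<partial>Pi\<^sub>M Basis (\<lambda>_. lborel))"
      using k by (subst lborel_eq) (auto simp: nn_integral_distr intro!: nn_integral_cong)
    also have "\<dots> = (\<integral>\<^sup>+ y. ennreal (F (\<Sum>b\<in>insert k (Basis - {k}). y b *\<^sub>R b)) * indicator A (y k) \<partial>Pi\<^sub>M (insert k (Basis - {k})) (\<lambda>_. lborel))"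
      using k by (simp add: insert_absorb)
    also have "\<dots> = (\<integral>\<^sup>+ r. (\<integral>\<^sup>+ y. ennreal (F (\<Sum>b\<in>insert k (Basis - {k}). (y(k := r)) b *\<^sub>R b)) * indicator A ((y(k := r)) k) \<partial>Pi\<^sub>M (Basis - {k}) (\<lambda>_. lborel)) \<partial>lborel)"
      by (subst product_sigma_finite.product_nn_integral_insert_rev[OF product_sigma_finite_lborel]) auto
    also have "\<dots> = (\<integral>\<^sup>+ r. ennreal (f r) * indicator A r \<partial>lborel)"
    proof (rule nn_integral_cong)
      fix r :: real
      have "(\<Sum>b\<in>insert k (Basis - {k}). (y(k := r)) b *\<^sub>R b) = (\<Sum>b\<in>Basis - {k}. y b *\<^sub>R b) + r *\<^sub>R k" for y :: "'a \<Rightarrow> real"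
        by (subst sum.insert) (auto simp: add.commute intro!: sum.cong)
      then show "(\<integral>\<^sup>+ y. ennreal (F (\<Sum>b\<in>insert k (Basis - {k}). (y(k := r)) b *\<^sub>R b)) * indicator A ((y(k := r)) k) \<partial>Pi\<^sub>M (Basis - {k}) (\<lambda>_. lborel)) = ennreal (f r) * indicator A r"
        unfolding f by (simp add: nn_integral_multc)
    qed
    also have "\<dots> = emeasure (density lborel (\<lambda>r. ennreal (f r))) A"
      by (simp add: emeasure_density)
    finally show "emeasure (distr (density lebesgue (\<lambda>x. ennreal (F x))) borel (\<lambda>x. x \<bullet> k)) A
      = emeasure (density lborel (\<lambda>r. ennreal (f r))) A" .
  qed simp
  moreover have "f r = 0" if r: "\<And>x. x \<bullet> k = r \<Longrightarrow> F x = 0" for r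
  proof -
    have "((\<Sum>b\<in>Basis - {k}. y b *\<^sub>R b) + r *\<^sub>R k) \<bullet> k = r" for y
    proof -
      have "(\<Sum>b\<in>Basis - {k}. y b *\<^sub>R b) \<bullet> k = 0"
        unfolding inner_sum_left using k by (intro sum.neutral) (auto simp: inner_not_same_Basis)
      then show ?thesis using k by (simp add: inner_add_left)
    qed
    then have "ennreal (f r) = 0" unfolding f using r by simp
    then show ?thesis using \<open>log_concave f\<close> by (simp add: log_concave_def ennreal_eq_0_iff order_antisym)
  qed
  ultimately show ?thesis using that[of f] by simp
qed

section \<open>Bisection\<close>

lemma log_concave_indicator:
  assumes "log_concave F" "convex P"
  shows "log_concave (\<lambda>x. indicator P x * F x)"
  unfolding log_concave_def
proof (intro conjI allI impI)
  have nn: "F x \<ge> 0" for x using assms by (simp add: log_concave_def)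
  then show "0 \<le> indicator P x * F x" for x by (simp add: indicator_def)
  fix x y and t :: real assume t: "0 \<le> t \<and> t \<le> 1"
  have F: "F x powr t * F y powr (1 - t) \<le> F (t *\<^sub>R x + (1 - t) *\<^sub>R y)"
    using assms t by (auto simp: log_concave_def)
  show "(indicator P x * F x) powr t * (indicator P y * F y) powr (1 - t)
    \<le> indicator P (t *\<^sub>R x + (1 - t) *\<^sub>R y) * F (t *\<^sub>R x + (1 - t) *\<^sub>R y)"
  proof (cases "x \<in> P \<and> y \<in> P")
    case True
    then have "t *\<^sub>R x + (1 - t) *\<^sub>R y \<in> P" using convexD[OF assms(2), of x y t "1 - t"] t by auto
    then show ?thesis using F True by simp
  next
    case False
    \<comment> \<open>A power with base 0 is 0 even for exponent 0, so the left-hand side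
      vanishes.\<close>
    then show ?thesis using nn by (auto simp: indicator_def)
  qed
qed

text \<open>Log-concavity supplies the regularity. On the open set \<open>U\<close> the function
  \<open>- ln F\<close> is convex, hence continuous, so \<open>F0\<close> is Borel; the positivity
  set is convex, so what is lost lies on its frontier, a null set. Boundedness comes from a ball
  around some \<open>x0\<close> on which \<open>F\<close> has a positive minimum: a very large
  \<open>F x\<close> would force a very small value opposite to \<open>x\<close> in that
  ball.\<close>

lemma log_concave_on_interior:
  fixes F :: "'a::euclidean_space \<Rightarrow> real"
  assumes lc: "log_concave F" and bdd: "bounded {x. 0 < F x}"
  defines "U \<equiv> interior {x. 0 < F x}"
  defines "F0 \<equiv> \<lambda>x. indicator U x * F x"
  shows "convex U" "log_concave F0" "F0 \<in> borel_measurable borel" "\<exists>C. \<forall>x. F0 x \<le> C"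
    "negligible {x. F x \<noteq> F0 x}"
proof -
  have nn: "F x \<ge> 0" for x using lc by (simp add: log_concave_def)
  have pos: "0 < F x" if "x \<in> U" for x using that interior_subset unfolding U_def by blast
  have lcD: "F x powr t * F y powr (1 - t) \<le> F (t *\<^sub>R x + (1 - t) *\<^sub>R y)"
    if "0 \<le> t" "t \<le> 1" for x y t using lc that by (auto simp: log_concave_def)
  have ln: "t * ln (F x) + (1 - t) * ln (F y) \<le> ln (F (t *\<^sub>R x + (1 - t) *\<^sub>R y))"
      "0 < F (t *\<^sub>R x + (1 - t) *\<^sub>R y)"
    if "0 \<le> t" "t \<le> 1" "0 < F x" "0 < F y" for x y t
  proof -
    have *: "exp (t * ln (F x) + (1 - t) * ln (F y)) \<le> F (t *\<^sub>R x + (1 - t) *\<^sub>R y)"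
      using lcD[OF that(1,2), of x y] that by (simp add: powr_def exp_add)
    then show "0 < F (t *\<^sub>R x + (1 - t) *\<^sub>R y)" using exp_gt_zero less_le_trans by blast
    then show "t * ln (F x) + (1 - t) * ln (F y) \<le> ln (F (t *\<^sub>R x + (1 - t) *\<^sub>R y))"
      using * by (simp add: ln_ge_iff)
  qed
  have convP: "convex {x. 0 < F x}"
    unfolding convex_alt using ln(2) by (auto simp: add.commute)
  then show cU: "convex U" unfolding U_def by (rule convex_interior)
  have oU: "open U" by (simp add: U_def)
  have "convex_on U (\<lambda>x. - ln (F x))"
    unfolding convex_on_alt using cU ln(1) pos by (force simp: algebra_simps)
  then have "continuous_on U (\<lambda>x. exp (- (- ln (F x))))"
    by (intro continuous_on_exp continuous_on_minus convex_on_continuous[OF oU])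
  then have cont: "continuous_on U F" by (rule continuous_on_eq) (use pos in auto)
  show "F0 \<in> borel_measurable borel"
    using borel_measurable_continuous_on_indicator[OF _ cont] oU by (simp add: F0_def)
  show "log_concave F0" unfolding F0_def by (rule log_concave_indicator[OF lc cU])
  show "negligible {x. F x \<noteq> F0 x}"
  proof (rule negligible_subset[OF negligible_convex_frontier[OF convP]])
    show "{x. F x \<noteq> F0 x} \<subseteq> frontier {x. 0 < F x}"
    proof
      fix x assume "x \<in> {x. F x \<noteq> F0 x}"
      then have "x \<notin> U" "F x \<noteq> 0" by (auto simp: F0_def indicator_def split: if_splits)
      then have "x \<notin> interior {x. 0 < F x}" "x \<in> {x. 0 < F x}" using nn[of x] by (auto simp: U_def)
      then show "x \<in> frontier {x. 0 < F x}"
        using subsetD[OF closure_subset] unfolding frontier_def by (intro DiffI)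
    qed
  qed
  show "\<exists>C. \<forall>x. F0 x \<le> C"
  proof (cases "U = {}")
    case True then show ?thesis by (auto simp: F0_def)
  next
    case False
    then obtain x0 where x0: "x0 \<in> U" by auto
    obtain r where r: "r > 0" "cball x0 r \<subseteq> U" using oU x0 open_contains_cball by blast
    obtain y0 where y0: "y0 \<in> cball x0 r" "\<And>y. y \<in> cball x0 r \<Longrightarrow> F y0 \<le> F y"
      using continuous_attains_inf[OF compact_cball _ continuous_on_subset[OF cont r(2)]] r by auto
    have "bounded U" using bdd interior_subset unfolding U_def by (rule bounded_subset)
    then obtain e where e: "\<And>x. x \<in> U \<Longrightarrow> dist x0 x \<le> e"
      using bounded_any_center[of U x0] by auto
    define D where "D = max e 1"
    have D: "D > 0" "\<And>x. x \<in> U \<Longrightarrow> dist x0 x \<le> D"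
      using e unfolding D_def by (auto intro: max.coboundedI1)
    \<comment> \<open>Reflecting \<open>x\<close> in \<open>x0\<close> and scaling by
      \<open>s\<close> gives a point \<open>y\<close> of the ball of radius \<open>r\<close>. Then
      \<open>x0\<close> divides the segment from \<open>y\<close> to \<open>x\<close> in a fixed
      ratio, and \<open>C\<close> is the bound on \<open>F x\<close> that concavity of
      \<open>ln F\<close> yields together with \<open>F y0 \<le> F y\<close>.\<close>
    define s where "s = r / D"
    have s: "s > 0" using r D by (simp add: s_def)
    define C where "C = exp (((1 + s) * ln (F x0) - ln (F y0)) / s)"
    have "F x \<le> C" if x: "x \<in> U" for x
    proof -
      define y where "y = x0 - s *\<^sub>R (x - x0)"
      have "dist x0 y = s * dist x0 x" using s by (simp add: y_def dist_norm norm_minus_commute)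
      also have "\<dots> \<le> s * D" using s D x by (intro mult_left_mono) auto
      finally have yb: "y \<in> cball x0 r" using D by (simp add: s_def)
      define t where "t = s / (1 + s)"
      have t: "0 \<le> t" "t \<le> 1" "1 - t = 1 / (1 + s)" using s by (auto simp: t_def field_simps)
      have "(1 + s) *\<^sub>R (t *\<^sub>R x + (1 - t) *\<^sub>R y) = s *\<^sub>R x + y"
        using s unfolding t(3) by (simp add: t_def scaleR_add_right)
      also have "\<dots> = (1 + s) *\<^sub>R x0" by (simp add: y_def algebra_simps)
      finally have "t *\<^sub>R x + (1 - t) *\<^sub>R y = x0" using s by simp
      then have "t * ln (F x) + (1 - t) * ln (F y) \<le> ln (F x0)"
        using ln(1)[OF t(1,2), of x y] pos x yb r by auto
      then have "(1 + s) * (t * ln (F x) + (1 - t) * ln (F y)) \<le> (1 + s) * ln (F x0)"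
        using s by (intro mult_left_mono) auto
      moreover have "(1 + s) * (t * ln (F x) + (1 - t) * ln (F y)) = s * ln (F x) + ln (F y)"
      proof -
        have "(1 + s) * t = s" "(1 + s) * (1 - t) = 1" using s unfolding t(3) by (auto simp: t_def)
        then show ?thesis by (simp only: distrib_left mult.assoc[symmetric] mult_1)
      qed
      moreover have "ln (F y0) \<le> ln (F y)"
        using y0 yb pos r by (subst ln_le_cancel_iff) auto
      ultimately have "s * ln (F x) \<le> (1 + s) * ln (F x0) - ln (F y0)" by linarith
      then have "ln (F x) \<le> ((1 + s) * ln (F x0) - ln (F y0)) / s" using s by (simp add: field_simps)
      then show ?thesis unfolding C_def using pos[OF x] by (metis exp_le_cancel_iff exp_ln)
    qed
    moreover have "C > 0" by (simp add: C_def)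
    ultimately show ?thesis by (intro exI[of _ C]) (auto simp: F0_def indicator_def)
  qed
qed

lemma measurable_lebesgue_AE_eq:
  fixes f g :: "'a::euclidean_space \<Rightarrow> real"
  assumes g: "g \<in> borel_measurable borel" and N: "negligible {x. f x \<noteq> g x}"
  shows "f \<in> borel_measurable lebesgue"
proof -
  have N': "{x. f x \<noteq> g x} \<in> null_sets lebesgue" using N negligible_iff_null_sets by blast
  have gl: "g \<in> borel_measurable lebesgue" using g by (auto intro: measurable_completion)
  show ?thesis
  proof (rule borel_measurableI_greater)
    fix c
    have "{x \<in> space lebesgue. c < f x} = ({x \<in> space lebesgue. c < g x} - {x. f x \<noteq> g x}) \<union> {x. f x \<noteq> g x \<and> c < f x}"
      by auto
    moreover have "{x. f x \<noteq> g x \<and> c < f x} \<in> null_sets lebesgue"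
      by (rule null_sets_completion_subset[OF _ N']) auto
    moreover have "{x \<in> space lebesgue. c < g x} \<in> sets lebesgue" using gl by measurable
    ultimately show "{x \<in> space lebesgue. c < f x} \<in> sets lebesgue"
      using N' by (auto intro!: sets.Un sets.Diff dest: null_setsD2)
  qed
qed

text \<open>Rotating a halfspace by \<open>\<pi>\<close> about \<open>z\<close> turns it into its complement, so the defect of
  the proportion changes sign on the way.\<close>
lemma equal_proportion_halfspace:
  fixes M :: "'a::euclidean_space measure"
  assumes "finite_measure M" and sets: "sets M = sets lebesgue"
    and null: "\<And>a b. a \<noteq> 0 \<Longrightarrow> {x. a \<bullet> x = b} \<in> null_sets M"
    and A: "A1 \<in> sets M" "A2 \<in> sets M" and m: "m2 * measure M A1 = m1 * measure M A2"
    and ij: "i \<in> Basis" "j \<in> Basis" "i \<noteq> j"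
  shows "\<exists>u v. u *\<^sub>R i + v *\<^sub>R j \<noteq> 0 \<and>
    m2 * measure M (A1 \<inter> {x. 0 < (u *\<^sub>R i + v *\<^sub>R j) \<bullet> (x - z)})
      = m1 * measure M (A2 \<inter> {x. 0 < (u *\<^sub>R i + v *\<^sub>R j) \<bullet> (x - z)})"
proof -
  interpret finite_measure M by fact
  define a where "a \<theta> = cos \<theta> *\<^sub>R i + sin \<theta> *\<^sub>R j" for \<theta> :: real
  have a_nz: "a \<theta> \<noteq> 0" for \<theta>
  proof
    assume "a \<theta> = 0"
    then have "a \<theta> \<bullet> i = 0" "a \<theta> \<bullet> j = 0" by auto
    then have "cos \<theta> = 0" "sin \<theta> = 0"
      using ij by (auto simp: a_def inner_add_left inner_not_same_Basis)
    then show False using sin_cos_squared_add[of \<theta>] by simp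
  qed
  define H where "H \<theta> = {x. 0 < a \<theta> \<bullet> (x - z)}" for \<theta>
  have H_sets: "H \<theta> \<in> sets M" for \<theta>
  proof -
    have "open (H \<theta>)" unfolding H_def by (intro open_Collect_less continuous_intros)
    then show ?thesis using sets by (simp add: lebesgue_openin)
  qed
  have hyp: "{x. a \<theta> \<bullet> (x - z) = 0} \<in> null_sets M" for \<theta>
    using null[OF a_nz, of \<theta> "a \<theta> \<bullet> z"] by (simp add: inner_diff_right)
  \<comment> \<open>The hyperplane at angle \<open>\<theta>\<close> is null, so for almost every
    \<open>x\<close> the sign of \<open>a \<theta> \<bullet> (x - z)\<close> is stable under small
    changes of the angle, and dominated convergence applies.\<close>
  have cont: "continuous_on UNIV (\<lambda>\<theta>. measure M (A \<inter> H \<theta>))" if AM: "A \<in> sets M" for A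
    unfolding continuous_on_sequentially
  proof (intro allI impI ballI)
    fix s :: "nat \<Rightarrow> real" and \<theta> assume "(\<forall>n. s n \<in> UNIV) \<and> s \<longlonglongrightarrow> \<theta>"
    then have s: "s \<longlonglongrightarrow> \<theta>" by simp
    have "(\<lambda>n. LINT x|M. indicator (A \<inter> H (s n)) x :: real) \<longlonglongrightarrow> (LINT x|M. indicator (A \<inter> H \<theta>) x)"
    proof (rule integral_dominated_convergence[where w = "\<lambda>_. 1"])
      have "AE x in M. x \<notin> {x. a \<theta> \<bullet> (x - z) = 0}" by (rule AE_not_in[OF hyp])
      then show "AE x in M. (\<lambda>n. indicator (A \<inter> H (s n)) x :: real) \<longlonglongrightarrow> indicator (A \<inter> H \<theta>) x"
      proof eventually_elim
        case (elim x)
        have lim: "(\<lambda>n. a (s n) \<bullet> (x - z)) \<longlonglongrightarrow> a \<theta> \<bullet> (x - z)"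
          unfolding a_def by (intro tendsto_intros s)
        have "\<forall>\<^sub>F n in sequentially. indicator (A \<inter> H (s n)) x = (indicator (A \<inter> H \<theta>) x :: real)"
        proof (cases "0 < a \<theta> \<bullet> (x - z)")
          case True
          show ?thesis using order_tendstoD(1)[OF lim True]
            by eventually_elim (use True in \<open>auto simp: H_def indicator_def\<close>)
        next
          case False
          then have neg: "a \<theta> \<bullet> (x - z) < 0" using elim by auto
          show ?thesis using order_tendstoD(2)[OF lim neg]
            by eventually_elim (use False in \<open>auto simp: H_def indicator_def\<close>)
        qed
        then show ?case by (rule tendsto_eventually)
      qed
    qed (use AM H_sets in \<open>auto simp: indicator_def\<close>)
    then show "((\<lambda>\<theta>. measure M (A \<inter> H \<theta>)) \<circ> s) \<longlonglongrightarrow> measure M (A \<inter> H \<theta>)"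
      using AM H_sets by (simp add: o_def sets.Int)
  qed
  define h where "h \<theta> = m2 * measure M (A1 \<inter> H \<theta>) - m1 * measure M (A2 \<inter> H \<theta>)" for \<theta>
  have cont_h: "continuous_on {0..pi} h" unfolding h_def
    by (intro continuous_intros continuous_on_subset[OF cont] A) auto
  have opp: "measure M (A \<inter> H pi) = measure M A - measure M (A \<inter> H 0)" if AM: "A \<in> sets M" for A
  proof -
    have Hpi: "H pi = {x. a 0 \<bullet> (x - z) < 0}" by (auto simp: H_def a_def)
    have "A = (A \<inter> H 0) \<union> (A \<inter> H pi) \<union> (A \<inter> {x. a 0 \<bullet> (x - z) = 0})"
      unfolding Hpi by (auto simp: H_def)
    moreover have "A \<inter> {x. a 0 \<bullet> (x - z) = 0} \<in> null_sets M"
      using hyp AM by (intro null_set_Int1) auto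
    ultimately have "measure M A = measure M ((A \<inter> H 0) \<union> (A \<inter> H pi))"
      using measure_Un_null_set[of "(A \<inter> H 0) \<union> (A \<inter> H pi)" M] AM H_sets by (metis sets.Int sets.Un)
    also have "\<dots> = measure M (A \<inter> H 0) + measure M (A \<inter> H pi)"
    proof (intro finite_measure_Union)
      show "A \<inter> H 0 \<inter> (A \<inter> H pi) = {}" unfolding Hpi by (auto simp: H_def)
    qed (use AM H_sets in auto)
    finally show ?thesis by simp
  qed
  \<comment> \<open>The half-spaces at angles 0 and \<open>pi\<close> split each set up to a null
    set, so \<open>h 0 + h pi\<close> equals \<open>m2 * measure M A1 - m1 * measure M A2\<close>,
    which is 0.\<close>
  have "h pi = - h 0" unfolding h_def opp[OF A(1)] opp[OF A(2)] using m by (simp add: algebra_simps)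
  then have "\<exists>\<theta>. 0 \<le> \<theta> \<and> \<theta> \<le> pi \<and> h \<theta> = 0"
    using IVT'[of h 0 0 pi] IVT2'[of h pi 0 0] cont_h pi_ge_zero by (cases "h 0 \<le> 0") auto
  then obtain \<theta> where "h \<theta> = 0" by auto
  then show ?thesis using a_nz[of \<theta>] by (intro exI[of _ "cos \<theta>"] exI[of _ "sin \<theta>"]) (simp add: h_def H_def a_def)
qed

text \<open>\<open>e\<close> stands for the constant value of \<open>G\<close>. The proportion
  passes to the second half by subtraction, and a strict inequality between sums stays strict for
  one of the summands. Both halves are open, at the cost of a null hyperplane.\<close>

lemma bisection_step:
  fixes M :: "'a::euclidean_space measure" and S1 S2 B :: "'a set" and m1 m2 c e :: real
  assumes "finite_measure M" and sets: "sets M = sets lebesgue"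
    and null: "\<And>a b. a \<noteq> 0 \<Longrightarrow> {x. a \<bullet> x = b} \<in> null_sets M"
    and S: "S1 \<in> sets M" "S2 \<in> sets M" "B \<in> sets M"
  defines "Q \<equiv> \<lambda>P. open P \<and> convex P \<and> m2 * measure M (S1 \<inter> P) = m1 * measure M (S2 \<inter> P)
      \<and> c * measure M (B \<inter> P) < e * measure M (S1 \<inter> P)"
  assumes P: "Q P" and ij: "i \<in> Basis" "j \<in> Basis" "i \<noteq> j"
  shows "\<exists>P'\<subseteq>P. Q P' \<and> (\<exists>u v. u *\<^sub>R i + v *\<^sub>R j \<noteq> 0 \<and> (\<forall>x\<in>P'. 0 < (u *\<^sub>R i + v *\<^sub>R j) \<bullet> (x - z)))"
proof -
  interpret finite_measure M by fact
  have P': "open P" "convex P" "m2 * measure M (S1 \<inter> P) = m1 * measure M (S2 \<inter> P)"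
    "c * measure M (B \<inter> P) < e * measure M (S1 \<inter> P)" using P by (auto simp: Q_def)
  have Ps: "P \<in> sets M" using P' sets by (simp add: lebesgue_openin)
  obtain u v where uv: "u *\<^sub>R i + v *\<^sub>R j \<noteq> 0" and
    eq: "m2 * measure M (S1 \<inter> P \<inter> {x. 0 < (u *\<^sub>R i + v *\<^sub>R j) \<bullet> (x - z)})
      = m1 * measure M (S2 \<inter> P \<inter> {x. 0 < (u *\<^sub>R i + v *\<^sub>R j) \<bullet> (x - z)})"
    using equal_proportion_halfspace[OF assms(1) sets null, of "S1 \<inter> P" "S2 \<inter> P" m2 m1 i j z] S Ps P' ij by auto
  define a where "a = u *\<^sub>R i + v *\<^sub>R j"
  define Hp Hm where "Hp = {x. 0 < a \<bullet> (x - z)}" and "Hm = {x. 0 < - a \<bullet> (x - z)}"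
  have op: "open Hp" "open Hm" unfolding Hp_def Hm_def by (intro open_Collect_less continuous_intros)+
  have cv: "convex Hp" "convex Hm"
    unfolding Hp_def Hm_def
    using convex_halfspace_gt[of "a \<bullet> z" a] convex_halfspace_lt[of a "a \<bullet> z"] by (auto simp: inner_diff_right)
  have Hs: "Hp \<in> sets M" "Hm \<in> sets M" using op sets by (simp_all add: lebesgue_openin)
  have hyp: "{x. a \<bullet> (x - z) = 0} \<in> null_sets M"
    using null[OF uv[folded a_def], of "a \<bullet> z"] by (simp add: inner_diff_right)
  have split: "measure M A = measure M (A \<inter> Hp) + measure M (A \<inter> Hm)" if AM: "A \<in> sets M" for A
  proof -
    have "A = (A \<inter> Hp) \<union> (A \<inter> Hm) \<union> (A \<inter> {x. a \<bullet> (x - z) = 0})" by (auto simp: Hp_def Hm_def)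
    moreover have "A \<inter> {x. a \<bullet> (x - z) = 0} \<in> null_sets M"
      using hyp AM by (intro null_set_Int1) auto
    ultimately have "measure M A = measure M ((A \<inter> Hp) \<union> (A \<inter> Hm))"
      using measure_Un_null_set[of "(A \<inter> Hp) \<union> (A \<inter> Hm)" M] AM Hs by (metis sets.Int sets.Un)
    also have "\<dots> = measure M (A \<inter> Hp) + measure M (A \<inter> Hm)"
      using AM Hs by (intro finite_measure_Union) (auto simp: Hp_def Hm_def)
    finally show ?thesis .
  qed
  have s1: "measure M (S1 \<inter> P) = measure M (S1 \<inter> P \<inter> Hp) + measure M (S1 \<inter> P \<inter> Hm)"
    and s2: "measure M (S2 \<inter> P) = measure M (S2 \<inter> P \<inter> Hp) + measure M (S2 \<inter> P \<inter> Hm)"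
    and sB: "measure M (B \<inter> P) = measure M (B \<inter> P \<inter> Hp) + measure M (B \<inter> P \<inter> Hm)"
    using split S Ps by auto
  have eqp: "m2 * measure M (S1 \<inter> P \<inter> Hp) = m1 * measure M (S2 \<inter> P \<inter> Hp)"
    using eq by (simp add: Hp_def a_def)
  have eqm: "m2 * measure M (S1 \<inter> P \<inter> Hm) = m1 * measure M (S2 \<inter> P \<inter> Hm)"
    using P'(3) eqp unfolding s1 s2 by (simp add: algebra_simps)
  have "c * measure M (B \<inter> P \<inter> Hp) < e * measure M (S1 \<inter> P \<inter> Hp) \<or>
      c * measure M (B \<inter> P \<inter> Hm) < e * measure M (S1 \<inter> P \<inter> Hm)"
    using P'(4) unfolding s1 sB by (simp add: algebra_simps) linarith
  then show ?thesis
  proof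
    assume "c * measure M (B \<inter> P \<inter> Hp) < e * measure M (S1 \<inter> P \<inter> Hp)"
    then have "Q (P \<inter> Hp)" using eqp P' op cv by (auto simp: Q_def Int_assoc convex_Int)
    then show ?thesis using uv by (intro exI[of _ "P \<inter> Hp"]) (auto simp: Hp_def a_def)
  next
    assume "c * measure M (B \<inter> P \<inter> Hm) < e * measure M (S1 \<inter> P \<inter> Hm)"
    then have "Q (P \<inter> Hm)" using eqm P' op cv by (auto simp: Q_def Int_assoc convex_Int)
    moreover have "(- u) *\<^sub>R i + (- v) *\<^sub>R j = - a" by (simp add: a_def)
    moreover have "- a \<noteq> 0" using uv unfolding a_def[symmetric] by simp
    ultimately show ?thesis
      by (intro exI[of _ "P \<inter> Hm"] conjI exI[of _ "- u"] exI[of _ "- v"]) (auto simp: Hm_def)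
  qed
qed

text \<open>There are countably many requirements, one for each pair of basis vectors and each point
  of \<open>D\<close>; dependent choice meets one per step. A cut, once made, constrains all later
  pieces because the pieces decrease.\<close>

lemma bisection_sequence:
  fixes M :: "'a::euclidean_space measure" and S1 S2 B D :: "'a set" and m1 m2 c e :: real
  assumes "finite_measure M" and sets: "sets M = sets lebesgue"
    and null: "\<And>a b. a \<noteq> 0 \<Longrightarrow> {x. a \<bullet> x = b} \<in> null_sets M"
    and S: "S1 \<in> sets M" "S2 \<in> sets M" "B \<in> sets M"
  defines "Q \<equiv> \<lambda>P. open P \<and> convex P \<and> m2 * measure M (S1 \<inter> P) = m1 * measure M (S2 \<inter> P)
      \<and> c * measure M (B \<inter> P) < e * measure M (S1 \<inter> P)"
  assumes U: "Q U" and D: "countable D" "D \<noteq> {}"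
  obtains P where "P 0 = U" "\<And>n. Q (P n)" "decseq P"
    "\<And>i j z. i \<in> Basis \<Longrightarrow> j \<in> Basis \<Longrightarrow> i \<noteq> j \<Longrightarrow> z \<in> D \<Longrightarrow>
      \<exists>n u v. u *\<^sub>R i + v *\<^sub>R j \<noteq> 0 \<and> (\<forall>x\<in>P n. 0 < (u *\<^sub>R i + v *\<^sub>R j) \<bullet> (x - z))"
proof -
  define T where "T = (Basis :: 'a set) \<times> (Basis :: 'a set) \<times> D"
  have T: "countable T" "T \<noteq> {}" using D by (auto simp: T_def countable_finite)
  define R where "R = (\<lambda>(i :: 'a, j, z) (P :: 'a set). i \<noteq> j \<longrightarrow>
     (\<exists>u v. u *\<^sub>R i + v *\<^sub>R j \<noteq> 0 \<and> (\<forall>x\<in>P. 0 < (u *\<^sub>R i + v *\<^sub>R j) \<bullet> (x - z))))"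
  have step: "\<exists>P'\<subseteq>P. Q P' \<and> R \<omega> P'" if "Q P" "\<omega> \<in> T" for P \<omega>
  proof -
    obtain i j z where \<omega>: "\<omega> = (i, j, z)" "i \<in> Basis" "j \<in> Basis"
      using \<open>\<omega> \<in> T\<close> unfolding T_def by (metis mem_Sigma_iff prod_cases3)
    show ?thesis
    proof (cases "i = j")
      case True then show ?thesis using that \<omega> by (intro exI[of _ P]) (auto simp: R_def)
    next
      case False
      then show ?thesis
        using bisection_step[OF assms(1) sets null S, of P m2 m1 c e i j z] that \<omega> unfolding Q_def R_def by auto
    qed
  qed
  have "\<exists>P. \<forall>n. (Q (P n) \<and> (n = 0 \<longrightarrow> P n = U)) \<and> P (Suc n) \<subseteq> P n \<and> R (from_nat_into T n) (P (Suc n))"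
  proof (rule dependent_nat_choice)
    show "\<exists>P. Q P \<and> (0 = (0::nat) \<longrightarrow> P = U)" using U by auto
    show "\<exists>P'. (Q P' \<and> (Suc n = 0 \<longrightarrow> P' = U)) \<and> P' \<subseteq> P \<and> R (from_nat_into T n) P'"
      if "Q P \<and> (n = 0 \<longrightarrow> P = U)" for P n
      using step[of P "from_nat_into T n"] that from_nat_into[OF T(2)] by auto
  qed
  then obtain P where P: "\<And>n. Q (P n)" "P 0 = U" "\<And>n. P (Suc n) \<subseteq> P n" "\<And>n. R (from_nat_into T n) (P (Suc n))"
    by blast
  show ?thesis
  proof (rule that[of P])
    show "P 0 = U" "\<And>n. Q (P n)" by (fact P)+
    show "decseq P" using P(3) by (rule decseq_SucI)
    fix i j z assume "i \<in> (Basis :: 'a set)" "j \<in> (Basis :: 'a set)" and ne: "i \<noteq> j" and "z \<in> D"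
    then have "(i, j, z) \<in> T" by (auto simp: T_def)
    then obtain n where "from_nat_into T n = (i, j, z)" using from_nat_into_surj[OF T(1)] by blast
    then show "\<exists>n u v. u *\<^sub>R i + v *\<^sub>R j \<noteq> 0 \<and> (\<forall>x\<in>P n. 0 < (u *\<^sub>R i + v *\<^sub>R j) \<bullet> (x - z))"
      using P(4)[of n] ne by (auto simp: R_def)
  qed
qed

section \<open>Thin pieces\<close>

lemma continuous_on_norm_function:
  fixes N :: "'a::euclidean_space \<Rightarrow> real"
  assumes "is_norm N"
  shows "continuous_on UNIV N"
proof (rule convex_on_continuous)
  show "convex_on UNIV N"
    unfolding convex_on_alt
  proof (intro conjI ballI allI impI)
    fix x y and t :: real assume "0 \<le> t \<and> t \<le> 1"
    then have "N (t *\<^sub>R x) = t * N x" "N ((1 - t) *\<^sub>R y) = (1 - t) * N y"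
      using assms by (auto simp: is_norm_def)
    then show "N (t *\<^sub>R x + (1 - t) *\<^sub>R y) \<le> t * N x + (1 - t) * N y"
      using assms unfolding is_norm_def by metis
  qed simp
qed simp

text \<open>In the plane of \<open>k\<close> and \<open>j\<close> the direction from
  \<open>x\<close> to \<open>w\<close> is that of \<open>j\<close> and the direction from
  \<open>u\<close> to \<open>v\<close> is not, so the four projections are not collinear and their
  centroid is interior to their hull. Quantitatively, if all four points lay in the half-space with
  normal \<open>a\<close> through \<open>z\<close>, four nonnegative numbers would have sum at most
  \<open>4 * (n * \<delta>)\<close>; their differences bound first \<open>q\<close> and then
  \<open>p\<close>, which is too small for the norm \<open>n\<close> of \<open>a\<close>.\<close>

lemma planar_centroid_interior:
  fixes u v x w :: "'a::euclidean_space"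
  assumes kj: "k \<in> Basis" "j \<in> Basis" "k \<noteq> j"
    and uv: "u \<bullet> k \<noteq> v \<bullet> k" and xw: "x \<bullet> k = w \<bullet> k" "x \<bullet> j \<noteq> w \<bullet> j"
  shows "\<exists>\<epsilon>>0. \<forall>z. dist ((1/4) *\<^sub>R (u + v + x + w)) z < \<epsilon> \<longrightarrow>
    \<not> (\<exists>p q. p *\<^sub>R k + q *\<^sub>R j \<noteq> 0 \<and> (\<forall>y\<in>{u, v, x, w}. 0 \<le> (p *\<^sub>R k + q *\<^sub>R j) \<bullet> (y - z)))"
proof -
  define X Y W where "X = \<bar>(x - w) \<bullet> j\<bar>" and "Y = \<bar>(v - u) \<bullet> k\<bar>" and "W = \<bar>(v - u) \<bullet> j\<bar>"
  have XYW: "X > 0" "Y > 0" "W \<ge> 0" using uv xw by (auto simp: X_def Y_def W_def inner_diff_left)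
  define z0 where "z0 = (1/4) *\<^sub>R (u + v + x + w)"
  \<comment> \<open>The estimate below ends in
    \<open>X * Y \<le> \<delta> * (4 * (X + Y + W))\<close>, which fails for
    \<open>\<delta> < \<epsilon>\<close>.\<close>
  define \<epsilon> where "\<epsilon> = X * Y / (4 * (X + Y + W))"
  have "\<epsilon> > 0" using XYW by (simp add: \<epsilon>_def)
  moreover have False
    if z: "dist z0 z < \<epsilon>" and a: "p *\<^sub>R k + q *\<^sub>R j \<noteq> 0"
      and pos: "\<forall>y\<in>{u, v, x, w}. 0 \<le> (p *\<^sub>R k + q *\<^sub>R j) \<bullet> (y - z)" for z p q
  proof -
    define a where "a = p *\<^sub>R k + q *\<^sub>R j"
    define n \<delta> where "n = norm a" and "\<delta> = dist z0 z"
    have n: "n > 0" using a by (simp add: n_def a_def)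
    have "n \<le> norm (p *\<^sub>R k) + norm (q *\<^sub>R j)" unfolding n_def a_def by (rule norm_triangle_ineq)
    then have npq: "n \<le> \<bar>p\<bar> + \<bar>q\<bar>" using kj by simp
    have "a \<bullet> (u - z) + a \<bullet> (v - z) + a \<bullet> (x - z) + a \<bullet> (w - z) = 4 * (a \<bullet> (z0 - z))"
      by (simp add: z0_def inner_diff_right inner_add_right)
    moreover have "a \<bullet> (z0 - z) \<le> n * \<delta>"
      using norm_cauchy_schwarz[of a "z0 - z"] by (simp add: n_def \<delta>_def dist_norm)
    moreover have "0 \<le> a \<bullet> (u - z)" "0 \<le> a \<bullet> (v - z)" "0 \<le> a \<bullet> (x - z)" "0 \<le> a \<bullet> (w - z)"
      using pos by (auto simp: a_def)
    ultimately have diff: "\<bar>a \<bullet> (x - z) - a \<bullet> (w - z)\<bar> \<le> 4 * (n * \<delta>)" "\<bar>a \<bullet> (v - z) - a \<bullet> (u - z)\<bar> \<le> 4 * (n * \<delta>)"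
      by linarith+
    have "a \<bullet> (x - z) - a \<bullet> (w - z) = q * ((x - w) \<bullet> j)"
      using xw by (simp add: a_def inner_diff_right inner_diff_left inner_add_left algebra_simps inner_commute)
    then have q: "\<bar>q\<bar> * X \<le> 4 * (n * \<delta>)" using diff(1) by (simp add: X_def abs_mult)
    have "a \<bullet> (v - z) - a \<bullet> (u - z) = p * ((v - u) \<bullet> k) + q * ((v - u) \<bullet> j)"
      by (simp add: a_def inner_diff_right inner_diff_left inner_add_left algebra_simps inner_commute)
    then have "\<bar>p * ((v - u) \<bullet> k)\<bar> \<le> 4 * (n * \<delta>) + \<bar>q * ((v - u) \<bullet> j)\<bar>" using diff(2) by linarith
    then have p: "\<bar>p\<bar> * Y \<le> 4 * (n * \<delta>) + \<bar>q\<bar> * W" by (simp add: Y_def W_def abs_mult)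
    have "n * (X * Y) \<le> (\<bar>p\<bar> + \<bar>q\<bar>) * (X * Y)" using npq XYW by (intro mult_right_mono) auto
    also have "\<dots> = X * (\<bar>p\<bar> * Y) + Y * (\<bar>q\<bar> * X)" by (simp add: algebra_simps)
    also have "\<dots> \<le> X * (4 * (n * \<delta>) + \<bar>q\<bar> * W) + Y * (4 * (n * \<delta>))"
      using p q XYW by (intro add_mono mult_left_mono) auto
    also have "\<dots> = X * (4 * (n * \<delta>)) + W * (\<bar>q\<bar> * X) + Y * (4 * (n * \<delta>))" by (simp add: algebra_simps)
    also have "\<dots> \<le> X * (4 * (n * \<delta>)) + W * (4 * (n * \<delta>)) + Y * (4 * (n * \<delta>))"
      using q XYW by (intro add_mono order_refl mult_left_mono) auto
    also have "\<dots> = n * (\<delta> * (4 * (X + Y + W)))" by (simp add: algebra_simps)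
    finally have "X * Y \<le> \<delta> * (4 * (X + Y + W))" using n by simp
    moreover have "\<delta> * (4 * (X + Y + W)) < X * Y"
      using z XYW unfolding \<epsilon>_def \<delta>_def by (subst (asm) pos_less_divide_eq) auto
    ultimately show False by simp
  qed
  ultimately show ?thesis unfolding z0_def by blast
qed

text \<open>\<open>u\<close> and \<open>v\<close> are extremal in a coordinate \<open>k\<close> that
  is not constant on \<open>K\<close>. A point \<open>x\<close> off the chord would share its
  \<open>k\<close>-coordinate with a point \<open>w\<close> of the chord and differ from it in some
  coordinate \<open>j\<close>. A point \<open>z\<close> of \<open>D\<close> near the centroid of the
  four points then contradicts \<open>sep\<close>.\<close>

lemma convex_set_is_segment:
  fixes K D :: "'a::euclidean_space set"
  assumes K: "compact K" "convex K"
    and dense: "\<And>U. open U \<Longrightarrow> U \<noteq> {} \<Longrightarrow> \<exists>z\<in>D. z \<in> U"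
    and sep: "\<And>i j z. i \<in> Basis \<Longrightarrow> j \<in> Basis \<Longrightarrow> i \<noteq> j \<Longrightarrow> z \<in> D \<Longrightarrow>
      \<exists>u v. u *\<^sub>R i + v *\<^sub>R j \<noteq> 0 \<and> (\<forall>x\<in>K. 0 \<le> (u *\<^sub>R i + v *\<^sub>R j) \<bullet> (x - z))"
    and two: "x1 \<in> K" "x2 \<in> K" "x1 \<noteq> x2"
  obtains k u v where "k \<in> Basis" "u \<in> K" "v \<in> K" "u \<bullet> k < v \<bullet> k"
    "\<And>x. x \<in> K \<Longrightarrow> u \<bullet> k \<le> x \<bullet> k \<and> x \<bullet> k \<le> v \<bullet> k \<and> (v \<bullet> k - u \<bullet> k) *\<^sub>R (x - u) = (x \<bullet> k - u \<bullet> k) *\<^sub>R (v - u)"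
proof -
  obtain k where k: "k \<in> Basis" "x1 \<bullet> k \<noteq> x2 \<bullet> k" using two euclidean_eqI by blast
  have cont: "continuous_on K (\<lambda>x. x \<bullet> k)" by (intro continuous_intros)
  obtain u where u: "u \<in> K" "\<And>x. x \<in> K \<Longrightarrow> u \<bullet> k \<le> x \<bullet> k"
    using continuous_attains_inf[OF K(1) _ cont] two by blast
  obtain v where v: "v \<in> K" "\<And>x. x \<in> K \<Longrightarrow> x \<bullet> k \<le> v \<bullet> k"
    using continuous_attains_sup[OF K(1) _ cont] two by blast
  have uv: "u \<bullet> k < v \<bullet> k" using u(2)[of x1] u(2)[of x2] v(2)[of x1] v(2)[of x2] two k by linarith
  have "(v \<bullet> k - u \<bullet> k) *\<^sub>R (x - u) = (x \<bullet> k - u \<bullet> k) *\<^sub>R (v - u)" if x: "x \<in> K" for x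
  proof -
    define s where "s = (x \<bullet> k - u \<bullet> k) / (v \<bullet> k - u \<bullet> k)"
    have s: "0 \<le> s" "s \<le> 1" "s * (v \<bullet> k - u \<bullet> k) = x \<bullet> k - u \<bullet> k"
      using u(2)[OF x] v(2)[OF x] uv by (auto simp: s_def)
    define w where "w = (1 - s) *\<^sub>R u + s *\<^sub>R v"
    have w: "w \<in> K" unfolding w_def using K(2) u v s by (intro convexD) auto
    have wk: "x \<bullet> k = w \<bullet> k" using s(3) by (simp add: w_def inner_add_left algebra_simps)
    have "x = w"
    proof (rule ccontr)
      assume "x \<noteq> w"
      then obtain j where j: "j \<in> Basis" "x \<bullet> j \<noteq> w \<bullet> j" using euclidean_eqI by blast
      then have "k \<noteq> j" using wk by auto
      then obtain \<epsilon> where \<epsilon>: "\<epsilon> > 0" "\<And>z. dist ((1/4) *\<^sub>R (u + v + x + w)) z < \<epsilon> \<Longrightarrow>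
        \<not> (\<exists>p q. p *\<^sub>R k + q *\<^sub>R j \<noteq> 0 \<and> (\<forall>y\<in>{u, v, x, w}. 0 \<le> (p *\<^sub>R k + q *\<^sub>R j) \<bullet> (y - z)))"
        using planar_centroid_interior[of k j u v x w] k j uv wk by auto
      obtain z where z: "z \<in> D" "z \<in> ball ((1/4) *\<^sub>R (u + v + x + w)) \<epsilon>"
        using dense[of "ball ((1/4) *\<^sub>R (u + v + x + w)) \<epsilon>"] \<epsilon>(1) by auto
      obtain p q where "p *\<^sub>R k + q *\<^sub>R j \<noteq> 0" "\<forall>y\<in>K. 0 \<le> (p *\<^sub>R k + q *\<^sub>R j) \<bullet> (y - z)"
        using sep[OF k(1) j(1) \<open>k \<noteq> j\<close> z(1)] by blast
      moreover have "{u, v, x, w} \<subseteq> K" using u v x w by auto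
      ultimately show False using \<epsilon>(2)[of z] z(2) unfolding mem_ball by blast
    qed
    then have "x - u = s *\<^sub>R (v - u)" by (simp add: w_def algebra_simps)
    then show ?thesis using s(3) by (simp add: mult.commute)
  qed
  then show ?thesis using that[of k u v] k u v uv by blast
qed

text \<open>Compactness turns a statement about the limit set into one about a single late
  piece.\<close>

lemma nested_compact_avoids_closed:
  fixes C :: "nat \<Rightarrow> 'b::heine_borel set"
  assumes "\<And>n. compact (C n)" "decseq C" "closed Z" "(\<Inter>n. C n) \<inter> Z = {}"
  shows "\<exists>n. C n \<inter> Z = {}"
proof (rule ccontr)
  assume ne: "\<not> ?thesis"
  have "\<Inter>(range (\<lambda>n. C n \<inter> Z)) \<noteq> {}"
    by (rule compact_nest) (use assms ne in \<open>auto simp: compact_Int_closed decseq_def\<close>)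
  then show False using assms(4) by auto
qed

text \<open>The closures decrease to a segment on which \<open>N\<close> is \<open>\<kappa>\<close>
  times one coordinate. There the width \<open>l\<close> and the separation
  \<open>q = t / \<kappa>\<close> satisfy \<open>(l - q) / q \<le> (d - t) / t < c\<close>, and the
  strict inequality survives on a late piece.\<close>

lemma thin_piece:
  fixes N :: "'a::euclidean_space \<Rightarrow> real" and P :: "nat \<Rightarrow> 'a set" and D :: "'a set"
  assumes N: "is_norm N" and P: "decseq P" "\<And>n. convex (P n)" "bounded (P 0)"
    and dense: "\<And>U. open U \<Longrightarrow> U \<noteq> {} \<Longrightarrow> \<exists>z\<in>D. z \<in> U"
    and sep: "\<And>i j z. i \<in> Basis \<Longrightarrow> j \<in> Basis \<Longrightarrow> i \<noteq> j \<Longrightarrow> z \<in> D \<Longrightarrow>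
      \<exists>n u v. u *\<^sub>R i + v *\<^sub>R j \<noteq> 0 \<and> (\<forall>x\<in>P n. 0 < (u *\<^sub>R i + v *\<^sub>R j) \<bullet> (x - z))"
    and diam: "\<And>a b. a \<in> closure (P 0) \<Longrightarrow> b \<in> closure (P 0) \<Longrightarrow> N (a - b) \<le> d"
    and t: "0 < t" and c: "(d - t) / t < c"
    and T: "\<And>n. T1 \<inter> P n \<noteq> {}" "\<And>n. T2 \<inter> P n \<noteq> {}"
    and dist: "\<And>a b. a \<in> T1 \<Longrightarrow> b \<in> T2 \<Longrightarrow> t \<le> N (a - b)"
  obtains k \<tau> n \<alpha> \<beta> where "k \<in> Basis" "0 < \<tau>" "\<And>x. x \<in> P n \<Longrightarrow> \<alpha> < x \<bullet> k \<and> x \<bullet> k < \<beta>"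
    "\<And>a b. a \<in> T1 \<inter> P n \<Longrightarrow> b \<in> T2 \<inter> P n \<Longrightarrow> \<tau> \<le> \<bar>a \<bullet> k - b \<bullet> k\<bar>" "(\<beta> - \<alpha> - \<tau>) / \<tau> \<le> c"
proof -
  have N0: "N x \<ge> 0" "N x = 0 \<longleftrightarrow> x = 0" "N (r *\<^sub>R x) = \<bar>r\<bar> * N x" for x r
    using N by (auto simp: is_norm_def)
  have contN: "continuous_on UNIV (\<lambda>(a, b). N (a - b))"
    unfolding case_prod_beta
    by (rule continuous_on_compose2[OF continuous_on_norm_function[OF N]]) (auto intro!: continuous_intros)
  define C where "C n = closure (P n)" for n
  have Cdec: "decseq C" using P(1) closure_mono unfolding decseq_def C_def by blast
  have Cc: "compact (C n)" for n
  proof -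
    have "bounded (P n)" using bounded_subset[OF P(3)] P(1) unfolding decseq_def by simp
    then show ?thesis by (simp add: C_def compact_closure)
  qed
  have C2: "compact (C n \<times> C n)" "decseq (\<lambda>n. C n \<times> C n)" for n
    using Cc Cdec unfolding decseq_def by (auto intro: compact_Times)
  have PC: "P n \<subseteq> C n" for n by (simp add: C_def closure_subset)
  have PP: "P n \<subseteq> P m" if "m \<le> n" for m n using P(1) that by (auto simp: decseq_def)
  define K where "K = (\<Inter>n. C n)"
  have K: "compact K" "convex K" unfolding K_def using Cc
    by (auto intro!: compact_Inter convex_INT convex_closure P(2) simp: C_def)
  have "K \<noteq> {}" unfolding K_def
  proof (rule compact_nest[OF Cc])
    show "C n \<noteq> {}" for n using T(1)[of n] PC[of n] by auto
  qed (use Cdec in \<open>auto simp: decseq_def\<close>)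
  then obtain x1 where x1: "x1 \<in> K" by auto
  have KK: "(\<Inter>n. C n \<times> C n) = K \<times> K" by (auto simp: K_def)
  \<comment> \<open>If the closures shrank to a point, all differences in a late piece would have
    norm below \<open>t\<close>, but each piece contains points of both \<open>T1\<close> and
    \<open>T2\<close>.\<close>
  have "\<exists>x2\<in>K. x1 \<noteq> x2"
  proof (rule ccontr)
    assume "\<not> ?thesis"
    then have "K \<subseteq> {x1}" by (metis singletonI subsetI)
    moreover have "{x1} \<subseteq> K" using x1 by simp
    ultimately have "K = {x1}" by (rule equalityI)
    then have "(\<Inter>n. C n \<times> C n) \<inter> {p. t \<le> (case p of (a, b) \<Rightarrow> N (a - b))} = {}"
      using t N0(2)[of 0] unfolding KK by auto
    then obtain n where "(C n \<times> C n) \<inter> {p. t \<le> (case p of (a, b) \<Rightarrow> N (a - b))} = {}"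
      using nested_compact_avoids_closed[OF C2 closed_Collect_le[OF continuous_on_const contN]] by blast
    moreover obtain a b where ab: "a \<in> T1" "a \<in> P n" "b \<in> T2" "b \<in> P n" using T by blast
    then have "(a, b) \<in> (C n \<times> C n) \<inter> {p. t \<le> (case p of (a, b) \<Rightarrow> N (a - b))}"
      using dist[OF ab(1,3)] subsetD[OF PC] by simp
    ultimately show False by (simp only: empty_iff)
  qed
  then obtain x2 where x2: "x2 \<in> K" "x1 \<noteq> x2" by auto
  have sepK: "\<exists>u v. u *\<^sub>R i + v *\<^sub>R j \<noteq> 0 \<and> (\<forall>x\<in>K. 0 \<le> (u *\<^sub>R i + v *\<^sub>R j) \<bullet> (x - z))"
    if ijz: "i \<in> Basis" "j \<in> Basis" "i \<noteq> j" "z \<in> D" for i j z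
  proof -
    obtain n u v where uv: "u *\<^sub>R i + v *\<^sub>R j \<noteq> 0" "\<And>x. x \<in> P n \<Longrightarrow> 0 < (u *\<^sub>R i + v *\<^sub>R j) \<bullet> (x - z)"
      using sep[OF ijz] by blast
    have "closed {x. 0 \<le> (u *\<^sub>R i + v *\<^sub>R j) \<bullet> (x - z)}" by (intro closed_Collect_le continuous_intros)
    then have "C n \<subseteq> {x. 0 \<le> (u *\<^sub>R i + v *\<^sub>R j) \<bullet> (x - z)}"
      unfolding C_def using uv(2) by (intro closure_minimal) (auto intro: less_imp_le)
    then show ?thesis using uv(1) unfolding K_def by blast
  qed
  obtain k u v where k: "k \<in> Basis" and uv: "u \<in> K" "v \<in> K" "u \<bullet> k < v \<bullet> k"
    and seg: "\<And>x. x \<in> K \<Longrightarrow> u \<bullet> k \<le> x \<bullet> k \<and> x \<bullet> k \<le> v \<bullet> k \<and> (v \<bullet> k - u \<bullet> k) *\<^sub>R (x - u) = (x \<bullet> k - u \<bullet> k) *\<^sub>R (v - u)"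
    using convex_set_is_segment[OF K dense sepK x1 x2] by blast
  define l where "l = v \<bullet> k - u \<bullet> k"
  have l: "l > 0" using uv by (simp add: l_def)
  define \<kappa> where "\<kappa> = N (v - u) / l"
  have "v - u \<noteq> 0" using uv by auto
  then have "N (v - u) > 0" using N0(1)[of "v - u"] N0(2)[of "v - u"] by linarith
  then have \<kappa>: "\<kappa> > 0" using l by (simp add: \<kappa>_def)
  have NK: "N (a - b) = \<kappa> * \<bar>a \<bullet> k - b \<bullet> k\<bar>" if "a \<in> K" "b \<in> K" for a b
  proof -
    have "l *\<^sub>R (a - b) = l *\<^sub>R (a - u) - l *\<^sub>R (b - u)" by (simp add: algebra_simps)
    also have "\<dots> = (a \<bullet> k - u \<bullet> k) *\<^sub>R (v - u) - (b \<bullet> k - u \<bullet> k) *\<^sub>R (v - u)"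
      using seg[OF that(1)] seg[OF that(2)] by (simp add: l_def)
    also have "\<dots> = (a \<bullet> k - b \<bullet> k) *\<^sub>R (v - u)" by (simp flip: scaleR_diff_left)
    finally have "N (l *\<^sub>R (a - b)) = N ((a \<bullet> k - b \<bullet> k) *\<^sub>R (v - u))" by simp
    then have "l * N (a - b) = \<bar>a \<bullet> k - b \<bullet> k\<bar> * N (v - u)" using l by (simp add: N0(3))
    then show ?thesis using l by (simp add: \<kappa>_def field_simps)
  qed
  have "\<kappa> * l \<le> d"
  proof -
    have "u \<in> C 0" "v \<in> C 0" using uv by (auto simp: K_def)
    then show ?thesis using diam[of v u] l by (simp add: \<kappa>_def C_def)
  qed
  define q where "q = t / \<kappa>"
  have q: "q > 0" "\<kappa> * q = t" using t \<kappa> by (auto simp: q_def)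
  define g where "g = c * q - (l - q)"
  have "\<kappa> * (l - q) < \<kappa> * (c * q)"
  proof -
    have "\<kappa> * (l - q) \<le> d - t" using \<open>\<kappa> * l \<le> d\<close> q by (simp add: algebra_simps)
    also have "\<dots> < c * t" using c t by (simp add: pos_divide_less_eq)
    also have "\<dots> = \<kappa> * (c * q)" using q(2) by (simp add: mult_ac)
    finally show ?thesis .
  qed
  then have g: "g > 0" using \<kappa> by (simp add: g_def)
  \<comment> \<open>A late piece overshoots the strip by less than \<open>\<epsilon>\<close> at
    either end and loses at most \<open>\<epsilon>\<close> of the separation. The aim \<open>l + 2 *
    \<epsilon> - (q - \<epsilon>) \<le> c * (q - \<epsilon>)\<close> amounts to
    \<open>\<epsilon> * (3 + c) \<le> g\<close>; the bound \<open>q / 2\<close> keeps the separation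
    positive.\<close>
  define \<epsilon> where "\<epsilon> = min (q / 2) (g / (3 + \<bar>c\<bar>))"
  have \<epsilon>: "\<epsilon> > 0" "\<epsilon> < q" using q g by (auto simp: \<epsilon>_def min_less_iff_disj)
  have "\<epsilon> * (3 + c) \<le> \<epsilon> * (3 + \<bar>c\<bar>)" using \<epsilon> by (intro mult_left_mono) auto
  also have "\<dots> \<le> g / (3 + \<bar>c\<bar>) * (3 + \<bar>c\<bar>)" by (intro mult_right_mono) (auto simp: \<epsilon>_def)
  finally have \<epsilon>g: "\<epsilon> * (3 + c) \<le> g" by simp
  have "(\<Inter>n. C n) \<inter> ({x. x \<bullet> k \<le> u \<bullet> k - \<epsilon>} \<union> {x. v \<bullet> k + \<epsilon> \<le> x \<bullet> k}) = {}"
    using seg \<epsilon> unfolding K_def[symmetric] by force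
  moreover have "closed ({x. x \<bullet> k \<le> u \<bullet> k - \<epsilon>} \<union> {x. v \<bullet> k + \<epsilon> \<le> x \<bullet> k})"
    by (intro closed_Un closed_Collect_le continuous_intros)
  ultimately obtain n1 where n1: "C n1 \<inter> ({x. x \<bullet> k \<le> u \<bullet> k - \<epsilon>} \<union> {x. v \<bullet> k + \<epsilon> \<le> x \<bullet> k}) = {}"
    using nested_compact_avoids_closed[OF Cc Cdec] by blast
  \<comment> \<open>The bad pairs: at distance at least \<open>t\<close>, with
    \<open>k\<close>-coordinates nevertheless too close. They form a closed set that misses
    \<open>K \<times> K\<close>.\<close>
  define Z where "Z = {p. t \<le> (case p of (a, b) \<Rightarrow> N (a - b))} \<inter> {p. \<bar>fst p \<bullet> k - snd p \<bullet> k\<bar> \<le> q - \<epsilon>}"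
  have "closed Z" unfolding Z_def
    by (intro closed_Int closed_Collect_le continuous_on_const contN) (intro continuous_intros)
  moreover have "(\<Inter>n. C n \<times> C n) \<inter> Z = {}"
  proof -
    have "\<not> \<bar>a \<bullet> k - b \<bullet> k\<bar> \<le> q - \<epsilon>" if "a \<in> K" "b \<in> K" "t \<le> N (a - b)" for a b
    proof
      assume "\<bar>a \<bullet> k - b \<bullet> k\<bar> \<le> q - \<epsilon>"
      then have "\<kappa> * \<bar>a \<bullet> k - b \<bullet> k\<bar> \<le> \<kappa> * (q - \<epsilon>)" using \<kappa> by simp
      also have "\<dots> < t" using \<kappa> \<epsilon> q(2) by (simp add: right_diff_distrib)
      finally show False using that(3) NK[OF that(1,2)] by simp
    qed
    then show ?thesis unfolding KK Z_def by auto
  qed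
  ultimately obtain n2 where n2: "(C n2 \<times> C n2) \<inter> Z = {}"
    using nested_compact_avoids_closed[OF C2] by blast
  define n where "n = max n1 n2"
  have PnC: "P n \<subseteq> C n1" "P n \<subseteq> C n2" using PP[of n1 n] PP[of n2 n] PC by (auto simp: n_def)
  show ?thesis
  proof (rule that[of k "q - \<epsilon>" n "u \<bullet> k - \<epsilon>" "v \<bullet> k + \<epsilon>"])
    show "u \<bullet> k - \<epsilon> < x \<bullet> k \<and> x \<bullet> k < v \<bullet> k + \<epsilon>" if "x \<in> P n" for x
      using that PnC(1) n1 by (force simp: not_le)
    show "q - \<epsilon> \<le> \<bar>a \<bullet> k - b \<bullet> k\<bar>" if "a \<in> T1 \<inter> P n" "b \<in> T2 \<inter> P n" for a b
    proof -
      have "(a, b) \<notin> Z" using that PnC(2) n2 by blast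
      then show ?thesis using dist[of a b] that by (auto simp: Z_def)
    qed
    have "l + 2 * \<epsilon> - (q - \<epsilon>) \<le> c * (q - \<epsilon>)"
      using \<epsilon>g by (simp add: g_def algebra_simps)
    then show "(v \<bullet> k + \<epsilon> - (u \<bullet> k - \<epsilon>) - (q - \<epsilon>)) / (q - \<epsilon>) \<le> c"
      using \<epsilon> by (simp add: l_def pos_divide_le_eq)
  qed (use k \<epsilon> in auto)
qed

section \<open>The isoperimetric inequality\<close>

context needle_bound begin

lemma thin_piece_bound:
  fixes F :: "'a::euclidean_space \<Rightarrow> real"
  assumes lc: "log_concave F" and F: "F \<in> borel_measurable borel" "\<exists>C. \<forall>x. F x \<le> C"
    and supp: "bounded {x. F x \<noteq> 0}" "\<And>x. F x \<noteq> 0 \<Longrightarrow> \<alpha> < x \<bullet> k \<and> x \<bullet> k < \<beta>" and k: "k \<in> Basis"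
    and fin: "finite_measure (density lebesgue (\<lambda>x. ennreal (F x)))" and "0 < \<tau>"
    and sets: "S1 \<in> sets lebesgue" "S2 \<in> sets lebesgue" "B \<in> sets lebesgue"
    and disj: "S1 \<inter> B = {}" "S2 \<inter> B = {}" "S1 \<inter> S2 = {}"
    and cover: "\<And>x. F x \<noteq> 0 \<Longrightarrow> x \<in> S1 \<union> S2 \<union> B"
    and range: "\<And>x. x \<in> S1 \<union> S2 \<Longrightarrow> \<alpha> < x \<bullet> k \<and> x \<bullet> k < \<beta>"
    and sep: "\<And>x y. x \<in> S1 \<Longrightarrow> y \<in> S2 \<Longrightarrow> \<tau> \<le> \<bar>x \<bullet> k - y \<bullet> k\<bar>"
  defines "M \<equiv> density lebesgue (\<lambda>x. ennreal (F x))"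
  assumes pos: "0 < measure M S1" "measure M S1 \<le> measure M S2"
  shows "measure M S1 * G ((measure M S1 + measure M S2) / measure M S1) \<le> (\<beta> - \<alpha> - \<tau>) / \<tau> * measure M B"
proof -
  obtain f where f: "log_concave f" "f \<in> borel_measurable borel"
    "distr M borel (\<lambda>x. x \<bullet> k) = density lborel (\<lambda>r. ennreal (f r))"
    "\<And>r. (\<And>x. x \<bullet> k = r \<Longrightarrow> F x = 0) \<Longrightarrow> f r = 0"
    using log_concave_coordinate_density[OF lc F supp(1) k] unfolding M_def by blast
  have [measurable]: "F \<in> borel_measurable lebesgue" using F by (auto intro: measurable_completion)
  show ?thesis
  proof (rule separated_sets_on_line[where X = "\<lambda>x. x \<bullet> k" and f = f])
    show "(\<lambda>x. x \<bullet> k) \<in> borel_measurable M" unfolding M_def by (auto intro: measurable_completion)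
    show "f x = 0" if "x \<notin> {\<alpha><..<\<beta>}" for x
    proof (rule f(4))
      fix y assume "y \<bullet> k = x" then show "F y = 0" using supp(2)[of y] that by auto
    qed
    show "AE x in M. x \<in> S1 \<union> S2 \<union> B" unfolding M_def
      using cover by (subst AE_density) auto
    show "(\<lambda>x. x \<bullet> k) ` (S1 \<union> S2) \<subseteq> {\<alpha><..<\<beta>}" using range by auto
    show "measure M S1 = min (measure M S1) (measure M S2)" using pos by simp
  qed (use f sets disj sep pos fin \<open>0 < \<tau>\<close> in \<open>auto simp: M_def\<close>)
qed

end

lemma measure_density_lebesgue:
  fixes F :: "'a::euclidean_space \<Rightarrow> real"
  assumes "F \<in> borel_measurable lebesgue" "\<And>x. 0 \<le> F x" "A \<in> sets lebesgue"
  shows "measure (density lebesgue (\<lambda>x. ennreal (F x))) A = (LINT x|lebesgue. indicator A x * F x)"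
proof -
  have "(LINT x|density lebesgue (\<lambda>x. ennreal (F x)). indicator A x :: real) = (LINT x|lebesgue. F x *\<^sub>R indicator A x)"
    using assms by (intro integral_density) auto
  then show ?thesis using assms by (simp add: mult.commute)
qed

theorem theorem2p2:
  fixes N :: "real^'n \<Rightarrow> real"
    and F :: "real^'n \<Rightarrow> real"
    and K S1 S2 B :: "(real^'n) set"
    and d t :: real
    and G :: "real \<Rightarrow> real"
  assumes norm: "is_norm N"
    and logc: "log_concave F"
    and supp: "K = closure {x. F x > 0}"
    and cpt: "compact K"
    and part: "K = S1 \<union> S2 \<union> B"
    and disj: "S1 \<inter> S2 = {}" "S1 \<inter> B = {}" "S2 \<inter> B = {}"
    and meas: "S1 \<in> sets lebesgue" "S2 \<in> sets lebesgue" "B \<in> sets lebesgue"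
    and mu_pos: "0 < muF F S1"
    and mu_le: "muF F S1 \<le> muF F S2"
    and diam: "\<forall>a\<in>K. \<forall>b\<in>K. N (a - b) \<le> d"
    and t_pos: "0 < t"
    and dist: "\<forall>a\<in>S1. \<forall>b\<in>S2. t \<le> N (a - b)"
    and G_nonneg: "\<forall>x\<ge>2. G x \<ge> 0"
    and G_mono: "mono_on {2..} G"
    and G_mono2: "mono_on {0<..1/2} (\<lambda>x. x * G (1 / x))"
    and one_dim: "\<forall>\<gamma> t' s. 0 < t' \<and> t' < 1 \<and> 0 \<le> s \<and> s + t' \<le> 1 \<and>
         0 < nu_exp \<gamma> {0..<s} \<and> nu_exp \<gamma> {0..<s} \<le> nu_exp \<gamma> {s+t'<..1} \<longrightarrow>
         (1 - t') / t' * nu_exp \<gamma> {s..s+t'}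
           \<ge> nu_exp \<gamma> {0..<s} * G (nu_exp \<gamma> ({0..1} - {s..s+t'}) / nu_exp \<gamma> {0..<s})"
  shows "(d - t) / t * muF F B \<ge> muF F S1 * G (muF F (K - B) / muF F S1)"
proof (rule ccontr)
  interpret needle_bound G
    using G_nonneg G_mono G_mono2 one_dim by unfold_locales (blast | assumption)+
  \<comment> \<open>\<open>F\<close> is replaced by a bounded Borel log-concave function that agrees
    with it almost everywhere; measurability of \<open>F\<close> itself follows from this. Masses
    are unchanged, and all pieces can be open subsets of \<open>U\<close>.\<close>
  define U where "U = interior {x. 0 < F x}"
  define F0 where "F0 x = indicator U x * F x" for x
  have bP: "bounded {x. 0 < F x}"
    using cpt unfolding supp by (meson bounded_subset closure_subset compact_imp_bounded)
  have F0_eq: "F0 = (\<lambda>x. indicator U x * F x)" by (simp add: F0_def fun_eq_iff)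
  have F0: "convex U" "log_concave F0" "F0 \<in> borel_measurable borel" "\<exists>C. \<forall>x. F0 x \<le> C"
    "negligible {x. F x \<noteq> F0 x}"
    unfolding F0_eq U_def by (rule log_concave_on_interior[OF logc bP])+
  have U: "open U" "convex U" "bounded U" "U \<subseteq> K"
    using F0(1) bounded_subset[OF bP interior_subset] closure_subset interior_subset
    unfolding U_def supp by auto
  have nn: "F0 x \<ge> 0" for x using F0(2) by (simp add: log_concave_def)
  have F0U: "x \<in> U" if "F0 x \<noteq> 0" for x using that by (auto simp: F0_def indicator_def split: if_splits)
  have F0l[measurable]: "F0 \<in> borel_measurable lebesgue" using F0(3) by (auto intro: measurable_completion)
  define M where "M = density lebesgue (\<lambda>x. ennreal (F0 x))"
  have setsM: "sets M = sets lebesgue" by (simp add: M_def)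
  have finM: "finite_measure M"
  proof
    obtain C where C: "\<And>x. F0 x \<le> C" using F0(4) by blast
    have "emeasure M (space M) = (\<integral>\<^sup>+ x. ennreal (F0 x) \<partial>lebesgue)"
      unfolding M_def by (subst emeasure_density) auto
    also have "\<dots> \<le> (\<integral>\<^sup>+ x. ennreal C * indicator U x \<partial>lebesgue)"
    proof (rule nn_integral_mono)
      show "ennreal (F0 x) \<le> ennreal C * indicator U x" for x
        using C[of x] F0U[of x] by (cases "F0 x = 0") (auto intro: ennreal_leI)
    qed
    also have "\<dots> = ennreal C * emeasure lebesgue U"
      using U(1) by (intro nn_integral_cmult_indicator) (simp add: lebesgue_openin)
    also have "\<dots> < \<infinity>" using U emeasure_bounded_finite[OF U(3)] by (simp add: ennreal_mult_less_top)
    finally show "emeasure M (space M) \<noteq> \<infinity>" by simp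
  qed
  then interpret M: finite_measure M .
  have null: "{x. a \<bullet> x = b} \<in> null_sets M" if "a \<noteq> 0" for a :: "real^'n" and b
  proof -
    have "{x. a \<bullet> x = b} \<in> null_sets lebesgue"
      using negligible_hyperplane[of a b] that negligible_iff_null_sets by blast
    moreover have "absolutely_continuous lebesgue M"
      unfolding M_def by (rule absolutely_continuousI_density) simp
    ultimately show ?thesis by (auto simp: absolutely_continuous_def)
  qed
  have muM: "muF F A = measure M A" if "A \<in> sets lebesgue" for A
  proof -
    have [measurable]: "F \<in> borel_measurable lebesgue" by (rule measurable_lebesgue_AE_eq[OF F0(3,5)])
    have "AE x in lebesgue. F x = F0 x"
      using F0(5) by (auto simp: eventually_ae_filter negligible_iff_null_sets)
    then have "muF F A = (LINT x|lebesgue. indicator A x * F0 x)"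
      unfolding muF_def set_lebesgue_integral_def using that
      by (intro integral_cong_AE) (auto elim: eventually_mono)
    then show ?thesis unfolding M_def using measure_density_lebesgue[OF F0l nn that] by simp
  qed
  define m1 m2 b where "m1 = measure M S1" and "m2 = measure M S2" and "b = measure M B"
  have m: "0 < m1" "m1 \<le> m2" using mu_pos mu_le meas by (auto simp: muM m1_def m2_def)
  define e where "e = G ((m1 + m2) / m1)"
  have "K - B = S1 \<union> S2" using part disj by auto
  then have "muF F (K - B) = m1 + m2"
    using meas disj M.finite_measure_Union[of S1 S2] by (simp add: muM setsM m1_def m2_def)
  moreover assume "\<not> ?thesis"
  ultimately have bad: "(d - t) / t * b < m1 * e"
    using meas by (simp add: muM m1_def b_def e_def)
  have "0 \<le> e" unfolding e_def using m by (intro G_nonneg[rule_format]) (simp add: field_simps)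
  \<comment> \<open>A fraction of the deficit in \<open>bad\<close> is added to
    \<open>(d - t) / t\<close>, small enough for the failure to persist. The denominator is
    \<open>b + 1\<close> because \<open>b\<close> may be 0.\<close>
  define c where "c = (d - t) / t + (m1 * e - (d - t) / t * b) / (b + 1)"
  have b0: "b \<ge> 0" by (simp add: b_def)
  have c: "(d - t) / t < c" using bad b0 by (simp add: c_def)
  have cb: "c * b < m1 * e"
  proof -
    have "(m1 * e - (d - t) / t * b) * b < (m1 * e - (d - t) / t * b) * (b + 1)"
      using bad by (intro mult_strict_left_mono) auto
    then have "(m1 * e - (d - t) / t * b) / (b + 1) * b < m1 * e - (d - t) / t * b"
      using b0 by (simp add: pos_divide_less_eq)
    then show ?thesis by (simp add: c_def distrib_right)
  qed
  have "S1 \<noteq> {}" "S2 \<noteq> {}" using m by (auto simp: m1_def m2_def)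
  then obtain y1 y2 where "y1 \<in> S1" "y2 \<in> S2" by auto
  then have "t \<le> N (y1 - y2)" "N (y1 - y2) \<le> d" using dist diam part by auto
  \<comment> \<open>Here \<open>t \<le> d\<close> has been shown. With \<open>c\<close> nonnegative,
    the strict failure on a piece forces \<open>S1\<close> to have positive mass there, so the
    bisection cannot drift into a trivial piece.\<close>
  then have c0: "0 \<le> c" using c t_pos by (smt (verit) divide_nonneg_pos)
  have MU: "measure M (A \<inter> U) = measure M A" if "A \<in> sets lebesgue" for A
  proof -
    have "AE x in M. x \<in> U" unfolding M_def using F0U by (subst AE_density) auto
    then have "AE x in M. x \<in> A \<inter> U \<longleftrightarrow> x \<in> A" by eventually_elim simp
    then show ?thesis
      by (rule measure_eq_AE) (use that U(1) setsM in \<open>simp_all add: lebesgue_openin sets.Int\<close>)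
  qed
  obtain D :: "(real^'n) set" where D: "countable D" "\<And>V. open V \<Longrightarrow> V \<noteq> {} \<Longrightarrow> \<exists>z\<in>D. z \<in> V"
    by (rule countable_dense_setE) blast
  have Dne: "D \<noteq> {}" using D(2)[of UNIV] by auto
  obtain P where P: "P 0 = U"
    "\<And>n. open (P n) \<and> convex (P n) \<and> m2 * measure M (S1 \<inter> P n) = m1 * measure M (S2 \<inter> P n)
      \<and> c * measure M (B \<inter> P n) < e * measure M (S1 \<inter> P n)"
    "decseq P"
    "\<And>i j z. i \<in> Basis \<Longrightarrow> j \<in> Basis \<Longrightarrow> i \<noteq> j \<Longrightarrow> z \<in> D \<Longrightarrow>
      \<exists>n u v. u *\<^sub>R i + v *\<^sub>R j \<noteq> 0 \<and> (\<forall>x\<in>P n. 0 < (u *\<^sub>R i + v *\<^sub>R j) \<bullet> (x - z))"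
  proof (rule bisection_sequence[OF finM setsM null])
    show "open U \<and> convex U \<and> m2 * measure M (S1 \<inter> U) = m1 * measure M (S2 \<inter> U)
      \<and> c * measure M (B \<inter> U) < e * measure M (S1 \<inter> U)"
      using U MU meas cb by (simp add: m1_def m2_def b_def mult.commute)
  qed (use meas setsM D(1) Dne in auto)
  have pos: "0 < measure M (S1 \<inter> P n)" "0 < measure M (S2 \<inter> P n)" for n
  proof -
    have "0 < e * measure M (S1 \<inter> P n)" using P(2)[of n] c0 by (smt (verit) measure_nonneg mult_nonneg_nonneg)
    then show p: "0 < measure M (S1 \<inter> P n)" using \<open>0 \<le> e\<close> by (simp add: zero_less_mult_iff)
    have "0 < m2 * measure M (S1 \<inter> P n)" using p m by simp
    then have "0 < m1 * measure M (S2 \<inter> P n)" using P(2)[of n] by simp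
    then show "0 < measure M (S2 \<inter> P n)" using m by (simp add: zero_less_mult_iff)
  qed
  have ne: "S1 \<inter> P n \<noteq> {}" "S2 \<inter> P n \<noteq> {}" for n using pos[of n] by auto
  have clU: "closure (P 0) \<subseteq> K" unfolding P(1) U_def supp by (intro closure_mono interior_subset)
  have convP: "convex (P n)" for n using P(2) by blast
  have bddP: "bounded (P 0)" using U P(1) by simp
  have diamP: "N (a - b) \<le> d" if "a \<in> closure (P 0)" "b \<in> closure (P 0)" for a b
    using diam that clU by auto
  have distS: "t \<le> N (a - b)" if "a \<in> S1" "b \<in> S2" for a b using dist that by blast
  obtain k \<tau> n \<alpha> \<beta> where k: "k \<in> Basis" and \<tau>: "0 < \<tau>"
    and strip: "\<And>x. x \<in> P n \<Longrightarrow> \<alpha> < x \<bullet> k \<and> x \<bullet> k < \<beta>"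
    and sep: "\<And>a b. a \<in> S1 \<inter> P n \<Longrightarrow> b \<in> S2 \<inter> P n \<Longrightarrow> \<tau> \<le> \<bar>a \<bullet> k - b \<bullet> k\<bar>"
    and \<tau>c: "(\<beta> - \<alpha> - \<tau>) / \<tau> \<le> c"
    using thin_piece[OF norm P(3) convP bddP D(2) P(4) diamP t_pos c ne distS] by blast
  define FP where "FP x = indicator (P n) x * F0 x" for x
  have FP_eq: "FP = (\<lambda>x. indicator (P n) x * F0 x)" by (simp add: FP_def fun_eq_iff)
  have Pn: "open (P n)" "convex (P n)" "P n \<subseteq> U" using P(1,2,3) by (auto simp: decseq_def)
  have Ps: "P n \<in> sets borel" using Pn by simp
  have Psl: "P n \<in> sets lebesgue" using Pn by (simp add: lebesgue_openin)
  have FPnz: "x \<in> P n" if "FP x \<noteq> 0" for x using that by (auto simp: FP_def indicator_def split: if_splits)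
  have FP: "log_concave FP" unfolding FP_eq by (rule log_concave_indicator[OF F0(2) Pn(2)])
  have FPm: "FP \<in> borel_measurable borel" unfolding FP_eq using F0(3) Ps by measurable
  have FPnn: "0 \<le> FP x" for x using nn by (simp add: FP_def)
  have FPle: "FP x \<le> F0 x" for x using nn by (simp add: FP_def indicator_def)
  define MP where "MP = density lebesgue (\<lambda>x. ennreal (FP x))"
  have MP: "measure MP A = measure M (A \<inter> P n)" if "A \<in> sets lebesgue" for A
  proof -
    have "FP \<in> borel_measurable lebesgue" using FPm by (auto intro: measurable_completion)
    then have "measure MP A = (LINT x|lebesgue. indicator A x * FP x)"
      unfolding MP_def using FPnn that by (rule measure_density_lebesgue)
    also have "\<dots> = (LINT x|lebesgue. indicator (A \<inter> P n) x * F0 x)"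
      by (intro Bochner_Integration.integral_cong) (auto simp: FP_def indicator_def)
    also have "\<dots> = measure M (A \<inter> P n)"
      unfolding M_def using that Pn by (intro measure_density_lebesgue[symmetric] F0l nn) (auto simp: lebesgue_openin)
    finally show ?thesis .
  qed
  have finMP: "finite_measure MP"
  proof
    have "emeasure MP (space MP) \<le> emeasure M (space M)"
      unfolding MP_def M_def using FPm FPle
      by (subst (1 2) emeasure_density) (auto intro!: nn_integral_mono ennreal_leI measurable_completion)
    then show "emeasure MP (space MP) \<noteq> \<infinity>" using M.emeasure_finite[of "space M"] by (auto simp: top_unique)
  qed
  define p1 p2 where "p1 = measure M (S1 \<inter> P n)" and "p2 = measure M (S2 \<inter> P n)"
  have p: "0 < p1" "m2 * p1 = m1 * p2" using pos P(2)[of n] by (auto simp: p1_def p2_def)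
  \<comment> \<open>The invariant gives \<open>m1 * p1 \<le> m2 * p1 = m1 * p2\<close>, so
    \<open>S1\<close> is still the lighter set on the piece.\<close>
  have "m1 * p1 \<le> m1 * p2" using m p by (metis less_imp_le mult_right_mono)
  then have p12: "p1 \<le> p2" using m by simp
  have MPS: "measure MP (S1 \<inter> P n) = p1" "measure MP (S2 \<inter> P n) = p2" "measure MP B = measure M (B \<inter> P n)"
    using MP[of "S1 \<inter> P n"] MP[of "S2 \<inter> P n"] MP[of B] meas Psl
    by (simp_all add: p1_def p2_def Int_assoc sets.Int)
  have "p1 * G ((p1 + p2) / p1) \<le> (\<beta> - \<alpha> - \<tau>) / \<tau> * measure M (B \<inter> P n)"
    unfolding MPS[symmetric] MP_def
  proof (rule thin_piece_bound[where k = k])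
    show "\<exists>C. \<forall>x. FP x \<le> C" using F0(4) FPle order_trans by meson
    show "bounded {x. FP x \<noteq> 0}" using U(3) Pn(3) FPnz by (auto intro: bounded_subset)
    show "x \<in> S1 \<inter> P n \<union> S2 \<inter> P n \<union> B" if "FP x \<noteq> 0" for x
      using FPnz[OF that] Pn(3) U(4) part by auto
    show "0 < measure (density lebesgue (\<lambda>x. ennreal (FP x))) (S1 \<inter> P n)"
      "measure (density lebesgue (\<lambda>x. ennreal (FP x))) (S1 \<inter> P n) \<le> measure (density lebesgue (\<lambda>x. ennreal (FP x))) (S2 \<inter> P n)"
      using MPS p p12 by (auto simp: MP_def)
  qed (use FP FPm FPnz strip k \<tau> sep meas Psl disj finMP in \<open>auto simp: MP_def\<close>)
  also have "\<dots> \<le> c * measure M (B \<inter> P n)" by (intro mult_right_mono \<tau>c) simp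
  also have "\<dots> < e * p1" using P(2)[of n] by (simp add: p1_def)
  \<comment> \<open>The masses on the piece keep the proportion of \<open>m1\<close> to
    \<open>m2\<close>, so \<open>G\<close> has the same argument as for the whole of
    \<open>K\<close>.\<close>
  also have "e = G ((p1 + p2) / p1)"
  proof -
    have "(m1 + m2) * p1 = m1 * (p1 + p2)" using p by (simp add: algebra_simps)
    then have "(m1 + m2) / m1 = (p1 + p2) / p1" using m p by (simp add: frac_eq_eq mult.commute)
    then show ?thesis by (simp add: e_def)
  qed
  finally show False by (simp add: mult.commute)
qed

end
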